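(* $H^1_1\subsetneqq\ell^1(\mathbb{D})\subsetneqq\mathcal{U}\subseteq T_o[H^\infty]$.
   Context: $\mathbb{D}$ is the open unit disk, $H(\mathbb{D})$ the set of analytic functions on $\mathbb{D}$, $H^1$ the Hardy space on $\mathbb{D}$, and $H^\infty$ the Banach space of bounded analytic functions on $\mathbb{D}$ with the supremum norm. Define $$H^1_1=\{g\in H(\mathbb{D}): g'\in H^1\},\qquad \ell^1(\mathbb{D})=\Big\{g(z)=\sum_{n=0}^\infty a_nz^n:\ \sum_{n=0}^\infty|a_n|<\infty\Big\}.$$ $\mathcal{U}$ is the set of $g\in H(\mathbb{D})$ whose derivative is uniformly integrable on radii: for every $\varepsilon>0$ there exists $r<1$, independent of $\theta$, such that $\int_r^1|g'(te^{i\theta})|\,dt\le\varepsilon$ for all $0\le\theta<2\pi$. For $g\in H(\mathbb{D})$, $T_gf(z)=\int_0^z f(t)g'(t)\,dt$, $z\in\mathbb{D}$, and $T_o[H^\infty]=\{g\in H(\mathbb{D}):T_g\text{ is a compact operator from }H^\infty\text{ into }H^\infty\}$. *)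

theory Defs
  imports "HOL-Complex_Analysis.Complex_Analysis"
begin

text \<open>
  An analytic function on the open unit disk \<^term>\<open>ball 0 1\<close> is represented by a total function
  that is holomorphic there. Membership in each of the sets of functions below depends only on the
  values of the function in the disk, so inclusions between them, strict or not, are those of the
  spaces of functions on the disk.
\<close>

abbreviation unit_disk :: "complex set" where
  "unit_disk \<equiv> ball 0 1"

definition hardy_1 :: "(complex \<Rightarrow> complex) set" where
  "hardy_1 = {f. f holomorphic_on unit_disk \<and>
     bdd_above ((\<lambda>r. 1 / (2 * pi) * integral {0..2*pi} (\<lambda>\<theta>. cmod (f (of_real r * cis \<theta>)))) ` {0..<1})}"

definition hardy_1_1 :: "(complex \<Rightarrow> complex) set" where
  "hardy_1_1 = {g. g holomorphic_on unit_disk \<and> deriv g \<in> hardy_1}"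

definition ell_1_disk :: "(complex \<Rightarrow> complex) set" where
  "ell_1_disk = {g. \<exists>a :: nat \<Rightarrow> complex. summable (\<lambda>n. cmod (a n)) \<and>
     (\<forall>z\<in>unit_disk. (\<lambda>n. a n * z ^ n) sums g z)}"

definition unif_integrable_radii :: "(complex \<Rightarrow> complex) set" where
  "unif_integrable_radii = {g. g holomorphic_on unit_disk \<and>
     (\<forall>\<epsilon>>0. \<exists>r. 0 \<le> r \<and> r < 1 \<and> (\<forall>\<theta>\<in>{0..<2*pi}.
        (\<integral>\<^sup>+ t \<in> {r..<1}. ennreal (cmod (deriv g (of_real t * cis \<theta>))) \<partial>lborel) \<le> ennreal \<epsilon>))}"

text \<open>
  The Banach space of bounded analytic functions on the disk with the supremum norm. Requiring
  the value 0 outside the disk makes the representing total function unique.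
\<close>

typedef hinf = "{f :: complex \<Rightarrow> complex. f holomorphic_on unit_disk \<and> bounded (f ` unit_disk) \<and>
                   (\<forall>z. z \<notin> unit_disk \<longrightarrow> f z = 0)}"
  morphisms hinf_apply Abs_hinf
proof
  show "(\<lambda>_. 0) \<in> {f :: complex \<Rightarrow> complex. f holomorphic_on unit_disk \<and> bounded (f ` unit_disk) \<and>
                   (\<forall>z. z \<notin> unit_disk \<longrightarrow> f z = 0)}"
    by (auto simp: image_constant_conv)
qed

setup_lifting type_definition_hinf

lemma hinf_holomorphic: "hinf_apply f holomorphic_on unit_disk"
  and hinf_bounded: "bounded (hinf_apply f ` unit_disk)"
  and hinf_outside: "z \<notin> unit_disk \<Longrightarrow> hinf_apply f z = 0"
  using hinf_apply[of f] by auto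

lemma hinf_eqI: "(\<And>z. z \<in> unit_disk \<Longrightarrow> hinf_apply f z = hinf_apply g z) \<Longrightarrow> f = g"
  by (metis hinf_apply_inject hinf_outside ext)

instantiation hinf :: real_vector
begin

lift_definition zero_hinf :: hinf is "\<lambda>_. 0"
  by (auto simp: image_constant_conv)

lift_definition plus_hinf :: "hinf \<Rightarrow> hinf \<Rightarrow> hinf" is "\<lambda>f g z. f z + g z"
  by (auto intro!: holomorphic_intros bounded_plus_comp)

lift_definition uminus_hinf :: "hinf \<Rightarrow> hinf" is "\<lambda>f z. - f z"
  by (auto intro!: holomorphic_intros simp: bounded_iff)

lift_definition minus_hinf :: "hinf \<Rightarrow> hinf \<Rightarrow> hinf" is "\<lambda>f g z. f z - g z"
  by (auto intro!: holomorphic_intros bounded_minus_comp)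

lift_definition scaleR_hinf :: "real \<Rightarrow> hinf \<Rightarrow> hinf" is "\<lambda>c f z. c *\<^sub>R f z"
  by (auto intro!: holomorphic_intros bounded_scaleR_comp)

instance
  by standard (transfer; simp add: fun_eq_iff algebra_simps)+

end

instantiation hinf :: real_normed_vector
begin

definition norm_hinf :: "hinf \<Rightarrow> real" where
  "norm_hinf f = (SUP z\<in>unit_disk. cmod (hinf_apply f z))"

definition dist_hinf :: "hinf \<Rightarrow> hinf \<Rightarrow> real" where
  "dist_hinf f g = norm (f - g)"

definition sgn_hinf :: "hinf \<Rightarrow> hinf" where
  "sgn_hinf f = inverse (norm f) *\<^sub>R f"

definition uniformity_hinf :: "(hinf \<times> hinf) filter" where
  "uniformity_hinf = (INF e\<in>{0 <..}. principal {(x, y). dist x y < e})"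

definition open_hinf :: "hinf set \<Rightarrow> bool" where
  "open_hinf U \<longleftrightarrow> (\<forall>x\<in>U. \<forall>\<^sub>F (x', y) in uniformity. x' = x \<longrightarrow> y \<in> U)"

lemma hinf_bdd_above: "bdd_above ((\<lambda>z. cmod (hinf_apply f z)) ` unit_disk)"
  using hinf_bounded[of f] by (auto simp: bounded_iff bdd_above_def)

lemma hinf_apply_le_norm: "z \<in> unit_disk \<Longrightarrow> cmod (hinf_apply f z) \<le> norm f"
  unfolding norm_hinf_def by (rule cSUP_upper[OF _ hinf_bdd_above])

lemma hinf_norm_leI: "(\<And>z. z \<in> unit_disk \<Longrightarrow> cmod (hinf_apply f z) \<le> b) \<Longrightarrow> norm f \<le> b"
  unfolding norm_hinf_def by (rule cSUP_least) auto

instance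
proof
  fix f g :: hinf and c :: real
  have nn: "0 \<le> norm f" for f :: hinf
    using hinf_apply_le_norm[of 0 f] norm_ge_zero[of "hinf_apply f 0"]
    by (metis centre_in_ball order_trans zero_less_one)
  show "(norm f = 0) = (f = 0)"
  proof
    assume "norm f = 0"
    then show "f = 0"
      using hinf_apply_le_norm[of _ f] by (intro hinf_eqI) (auto simp: zero_hinf.rep_eq)
  next
    assume "f = 0"
    then have "norm f \<le> 0" by (intro hinf_norm_leI) (simp add: zero_hinf.rep_eq)
    with nn[of f] show "norm f = 0" by simp
  qed
  show "norm (f + g) \<le> norm f + norm g"
  proof (rule hinf_norm_leI)
    fix z :: complex assume z: "z \<in> unit_disk"
    show "cmod (hinf_apply (f + g) z) \<le> norm f + norm g"
      using norm_triangle_ineq[of "hinf_apply f z" "hinf_apply g z"]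
        hinf_apply_le_norm[OF z, of f] hinf_apply_le_norm[OF z, of g]
      by (simp add: plus_hinf.rep_eq)
  qed
  have le: "norm (c *\<^sub>R f) \<le> \<bar>c\<bar> * norm f" for c :: real and f :: hinf
    by (rule hinf_norm_leI) (simp add: scaleR_hinf.rep_eq mult_left_mono hinf_apply_le_norm)
  show "norm (c *\<^sub>R f) = \<bar>c\<bar> * norm f"
  proof (cases "c = 0")
    case True
    then show ?thesis using le[of c f] nn[of "c *\<^sub>R f"] by simp
  next
    case False
    then have "norm f \<le> \<bar>inverse c\<bar> * norm (c *\<^sub>R f)"
      using le[of "inverse c" "c *\<^sub>R f"] by simp
    with False le[of c f] show ?thesis by (simp add: field_simps)
  qed
qed (simp_all add: dist_hinf_def sgn_hinf_def uniformity_hinf_def open_hinf_def)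

end

instance hinf :: banach
proof
  fix X :: "nat \<Rightarrow> hinf"
  assume X: "Cauchy X"
  have diff: "cmod (hinf_apply (X m) z - hinf_apply (X n) z) \<le> dist (X m) (X n)"
    if "z \<in> unit_disk" for m n z
    using hinf_apply_le_norm[OF that, of "X m - X n"] by (simp add: dist_hinf_def minus_hinf.rep_eq)
  have "uniformly_Cauchy_on unit_disk (\<lambda>n. hinf_apply (X n))"
    unfolding uniformly_Cauchy_on_def dist_norm
    using X diff by (meson metric_CauchyD order_le_less_trans)
  then obtain l where l: "uniform_limit unit_disk (\<lambda>n. hinf_apply (X n)) l sequentially"
    using Cauchy_uniformly_convergent by (auto simp: uniformly_convergent_on_def)
  have hol: "l holomorphic_on unit_disk"
  proof (rule holomorphic_uniform_sequence)
    show "hinf_apply (X n) holomorphic_on unit_disk" for n by (rule hinf_holomorphic)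
    show "\<exists>d>0. cball x d \<subseteq> unit_disk \<and> uniform_limit (cball x d) (\<lambda>n. hinf_apply (X n)) l sequentially"
      if "x \<in> unit_disk" for x
      using that l by (meson open_ball open_contains_cball uniform_limit_on_subset)
  qed simp
  have bdd: "bounded (l ` unit_disk)"
    by (rule uniform_limit_bounded[OF l]) (simp_all add: hinf_bounded)
  define f where "f = Abs_hinf (\<lambda>z. if z \<in> unit_disk then l z else 0)"
  have "(\<lambda>z. if z \<in> unit_disk then l z else 0) holomorphic_on unit_disk"
    using hol by (rule holomorphic_transform) simp
  moreover have "bounded ((\<lambda>z. if z \<in> unit_disk then l z else 0) ` unit_disk)"
    using bdd by (simp add: bounded_iff)
  ultimately have f: "hinf_apply f z = l z" if "z \<in> unit_disk" for z
    unfolding f_def using that by (subst Abs_hinf_inverse) auto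
  have "X \<longlonglongrightarrow> f"
  proof (rule metric_LIMSEQ_I)
    fix e :: real assume "0 < e"
    then have "\<forall>\<^sub>F n in sequentially. \<forall>z\<in>unit_disk. dist (hinf_apply (X n) z) (l z) < e / 2"
      using l unfolding uniform_limit_iff by (meson half_gt_zero)
    then obtain N where N: "\<And>n z. n \<ge> N \<Longrightarrow> z \<in> unit_disk \<Longrightarrow> dist (hinf_apply (X n) z) (l z) < e / 2"
      unfolding eventually_sequentially by blast
    have "dist (X n) f \<le> e / 2" if "n \<ge> N" for n
      unfolding dist_hinf_def using N[OF that]
      by (intro hinf_norm_leI) (auto simp: minus_hinf.rep_eq f dist_norm intro: less_imp_le)
    with \<open>0 < e\<close> show "\<exists>N. \<forall>n\<ge>N. dist (X n) f < e" by force
  qed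
  then show "convergent X" by (auto simp: convergent_def)
qed

text \<open>The segment from 0 to z serves as the path of integration; it lies in the disk.\<close>

definition volterra :: "(complex \<Rightarrow> complex) \<Rightarrow> (complex \<Rightarrow> complex) \<Rightarrow> complex \<Rightarrow> complex" where
  "volterra g f z = contour_integral (linepath 0 z) (\<lambda>t. f t * deriv g t)"

definition compact_operator :: "('a::real_normed_vector \<Rightarrow> 'b::real_normed_vector) \<Rightarrow> bool" where
  "compact_operator T \<longleftrightarrow> linear T \<and> (\<forall>S. bounded S \<longrightarrow> compact (closure (T ` S)))"

text \<open>
  The existence of \<open>T\<close> says that the operator with symbol \<open>g\<close> maps the space into itself; such a
  \<open>T\<close> is then unique, and it is complex linear because \<^const>\<open>volterra\<close> is.
\<close>

definition compact_volterra_hinf :: "(complex \<Rightarrow> complex) set" where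
  "compact_volterra_hinf = {g. g holomorphic_on unit_disk \<and>
     (\<exists>T :: hinf \<Rightarrow> hinf. compact_operator T \<and>
        (\<forall>f. \<forall>z\<in>unit_disk. hinf_apply (T f) z = volterra g (hinf_apply f) z))}"

end

theory Submission
  imports Defs
begin

text \<open>
  The first inclusion is Hardy's inequality \<open>\<Sum>n. |c n| / (n + 1) \<le> C \<parallel>f\<parallel>\<close> for \<open>f = deriv g\<close> in \<open>H\<^sup>1\<close>
  with coefficients \<open>c n\<close>, because the coefficients of \<open>g\<close> are \<open>c n / (n + 1)\<close>. It is proved by writing
  \<open>f\<close> as a product of two functions whose squared absolute values on the circle are at most a multiple of
  \<open>|f| + 1\<close> (\<open>factor_on_circle\<close>). The coefficients of the factors are square summable by Bessel's inequality, and
  Hilbert's inequality bounds their Cauchy product (\<open>hilbert_inequality\<close>, \<open>hardy_inequality\<close>). The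
  factorization comes from approximation instead of Blaschke products: real parts of polynomials are
  dense in the continuous functions on the circle, so some polynomial \<open>h\<close> has real part close to
  \<open>log (|f| + 1) / 2\<close>, and \<open>f = exp h \<cdot> (f exp (- h))\<close>. This needs \<open>f\<close> on the closed disc, which a
  dilation provides.

  For the second inclusion, \<open>|deriv g z|\<close> is at most \<open>\<Sum>n. n |a n| |z|^(n - 1)\<close>, which depends on \<open>|z|\<close>
  only and has the integral \<open>\<Sum>n. |a n| (1 - r^n)\<close> over \<open>[r, 1)\<close>; this tends to 0 as \<open>r\<close> tends to 1.

  For the third inclusion, the integral defining \<open>volterra g f z\<close> is split at radius \<open>r\<close>. The outer part
  is small uniformly in \<open>z\<close> and in bounded \<open>f\<close>, and the inner part is controlled by \<open>f\<close> on a compact disc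
  (\<open>volterra_bound\<close>). Hence the operator maps locally uniformly convergent bounded sequences to
  norm convergent ones, and Montel's theorem makes the image of a ball compact.

  The first inclusion is strict because coefficients of \<open>H\<^sup>1\<close> functions are bounded, whereas those of the
  derivative of the lacunary series \<open>\<Sum>k. (3/4)^k z^(2^k)\<close> are not. The second is strict because of
  cancellation: with Rudin-Shapiro signs \<open>\<epsilon> n\<close>, the function \<open>\<Sum>n. \<epsilon> n z^(n + 1) / (n + 1)\<close> has the
  coefficients of the harmonic series up to sign, but the block of its derivative with degrees between
  \<open>2^k\<close> and \<open>2^(k + 1)\<close> has size \<open>|z|^(2^k) 2^((k + 1) / 2)\<close>, with the summable radial integrals
  \<open>2^((k + 1) / 2) / 2^k\<close> as bounds.
\<close>

section \<open>Power series on discs\<close>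

lemma coeff_eq_higher_deriv:
  fixes f :: "complex \<Rightarrow> complex"
  assumes "0 < R" and S: "\<And>z. z \<in> ball 0 R \<Longrightarrow> (\<lambda>n. c n * z ^ n) sums f z"
  shows "c n = (deriv ^^ n) f 0 / fact n"
proof -
  have "f has_fps_expansion Abs_fps c"
    using S \<open>0 < R\<close> by (intro has_fps_expansionI eventually_nhds_in_open[THEN eventually_mono, of "ball 0 R"]) auto
  from fps_nth_fps_expansion[OF this, of n] show ?thesis by simp
qed

lemma power_series_holomorphic_ball:
  fixes f :: "complex \<Rightarrow> complex"
  assumes "\<And>z. z \<in> ball 0 R \<Longrightarrow> (\<lambda>n. c n * z ^ n) sums f z"
  shows "f holomorphic_on ball 0 R"
  by (rule power_series_holomorphic[where a = c]) (use assms in simp)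

lemma deriv_coefficient:
  fixes g :: "complex \<Rightarrow> complex"
  assumes "0 < R" and S: "\<And>z. z \<in> ball 0 R \<Longrightarrow> (\<lambda>n. a n * z ^ n) sums g z"
  shows "(deriv ^^ n) (deriv g) 0 / fact n = of_nat (Suc n) * a (Suc n)"
  using coeff_eq_higher_deriv[of R a g "Suc n", OF assms]
  by (simp add: funpow_swap1 field_simps del: of_nat_Suc)

lemma deriv_power_series:
  fixes g :: "complex \<Rightarrow> complex"
  assumes S: "\<And>z. z \<in> unit_disk \<Longrightarrow> (\<lambda>n. a n * z ^ n) sums g z" and z: "z \<in> unit_disk"
  shows "(\<lambda>n. of_nat (Suc n) * a (Suc n) * z ^ n) sums deriv g z"
proof -
  have "g holomorphic_on unit_disk" using S by (rule power_series_holomorphic_ball)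
  hence hol: "deriv g holomorphic_on unit_disk" by (simp add: holomorphic_deriv)
  show ?thesis
    using holomorphic_power_series[OF hol z] by (simp only: deriv_coefficient[OF zero_less_one S] diff_0_right)
qed

lemma summable_norm_power_series:
  fixes a :: "nat \<Rightarrow> complex"
  assumes "summable (\<lambda>n. cmod (a n))" and "z \<in> unit_disk"
  shows "(\<lambda>n. a n * z ^ n) sums (\<Sum>n. a n * z ^ n)"
proof (rule summable_sums, rule summable_comparison_test'[OF assms(1)])
  show "norm (a n * z ^ n) \<le> cmod (a n)" for n
    using assms(2) by (simp add: norm_mult norm_power mult_left_le power_le_one)
qed

lemma dilation_power_series:
  fixes f :: "complex \<Rightarrow> complex"
  assumes hol: "f holomorphic_on unit_disk" and "0 < r" and z: "z \<in> ball 0 (1 / r)"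
  shows "(\<lambda>n. (deriv ^^ n) f 0 / fact n * of_real r ^ n * z ^ n) sums f (of_real r * z)"
proof -
  have "of_real r * z \<in> unit_disk" using z \<open>0 < r\<close> by (simp add: norm_mult field_simps)
  from holomorphic_power_series[OF hol this] show ?thesis by (simp add: power_mult_distrib mult_ac)
qed

section \<open>Fourier coefficients on the unit circle\<close>

text \<open>
  Cauchy's integral formula for the derivatives at the centre, parametrised by the angle.
\<close>

lemma circle_fourier_coefficient:
  fixes f :: "complex \<Rightarrow> complex"
  assumes "1 < R" and S: "\<And>z. z \<in> ball 0 R \<Longrightarrow> (\<lambda>n. c n * z ^ n) sums f z"
  shows "((\<lambda>\<theta>. f (cis \<theta>) * cnj (cis (real n * \<theta>))) has_integral of_real (2 * pi) * c n) {0..2*pi}"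
proof -
  have hol: "f holomorphic_on ball 0 R" using S by (rule power_series_holomorphic_ball)
  have sub: "cball 0 1 \<subseteq> ball (0::complex) R" using \<open>1 < R\<close> by auto
  have c: "c n = (deriv ^^ n) f 0 / fact n"
    using \<open>1 < R\<close> by (intro coeff_eq_higher_deriv[OF _ S]) auto
  have "((\<lambda>u. f u / (u - 0) ^ Suc n) has_contour_integral
      ((2 * pi * \<i>) / fact n * (deriv ^^ n) f 0)) (circlepath 0 1)"
    using hol sub \<open>1 < R\<close>
    by (intro Cauchy_has_contour_integral_higher_derivative_circlepath)
       (auto intro!: holomorphic_on_imp_continuous_on elim: holomorphic_on_subset)
  hence "((\<lambda>t. f (cis t) / cis t ^ Suc n * \<i> * cis t) has_integral (2 * pi * \<i>) * c n) {0..2*pi}"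
    by (simp add: circlepath_def has_contour_integral_part_circlepath_iff c)
  from has_integral_mult_right[OF this, of "- \<i>"]
  have "((\<lambda>t. - \<i> * (f (cis t) / cis t ^ Suc n * \<i> * cis t)) has_integral of_real (2 * pi) * c n) {0..2*pi}"
    by (simp add: mult_ac)
  moreover have "- \<i> * (f (cis t) / cis t ^ Suc n * \<i> * cis t) = f (cis t) * cnj (cis (real n * t))" for t
  proof -
    have "cnj (cis (real n * t)) = inverse (cis t ^ n)" by (simp only: Complex.DeMoivre cis_inverse cis_cnj)
    moreover have "- \<i> * (F / w ^ Suc n * \<i> * w) = F * inverse (w ^ n)" if "w \<noteq> 0" for F w
      using that by (simp add: field_simps)
    ultimately show ?thesis by simp
  qed
  ultimately show ?thesis by simp
qed

text \<open>
  The inner product of \<open>f\<close> with a partial sum of its series sees only the coefficients of that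
  partial sum. Taking \<open>f\<close> to be the partial sum itself computes the norm of the partial sum, so this
  one identity provides both terms that Bessel's inequality needs.
\<close>

lemma inner_product_with_partial_sum:
  fixes f :: "complex \<Rightarrow> complex"
  assumes "1 < R" and S: "\<And>z. z \<in> ball 0 R \<Longrightarrow> (\<lambda>n. c n * z ^ n) sums f z"
  shows "((\<lambda>\<theta>. f (cis \<theta>) * cnj (\<Sum>n<N. c n * cis \<theta> ^ n)) has_integral
           of_real (2 * pi * (\<Sum>n<N. (cmod (c n))\<^sup>2))) {0..2*pi}"
proof -
  have "((\<lambda>\<theta>. \<Sum>n<N. cnj (c n) * (f (cis \<theta>) * cnj (cis (real n * \<theta>)))) has_integral
           (\<Sum>n<N. cnj (c n) * (of_real (2 * pi) * c n))) {0..2*pi}"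
    by (intro has_integral_sum has_integral_mult_right circle_fourier_coefficient[OF assms]) auto
  moreover have "(\<Sum>n<N. cnj (c n) * (of_real (2 * pi) * c n)) = of_real (2 * pi * (\<Sum>n<N. (cmod (c n))\<^sup>2))"
    by (simp only: of_real_mult of_real_sum complex_norm_square sum_distrib_left mult_ac)
  moreover have "(\<Sum>n<N. cnj (c n) * (f (cis \<theta>) * cnj (cis (real n * \<theta>))))
      = f (cis \<theta>) * cnj (\<Sum>n<N. c n * cis \<theta> ^ n)" for \<theta>
    unfolding Complex.DeMoivre [symmetric] cnj_sum complex_cnj_mult sum_distrib_left by (simp only: mult_ac)
  ultimately show ?thesis by simp
qed

text \<open>
  The usual expansion of the integral of \<open>|f - s|\<^sup>2\<close>, where \<open>s\<close> is a partial sum of the series.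
\<close>

lemma bessel_inequality_circle:
  fixes f :: "complex \<Rightarrow> complex"
  assumes "1 < R" and S: "\<And>z. z \<in> ball 0 R \<Longrightarrow> (\<lambda>n. c n * z ^ n) sums f z"
  shows "2 * pi * (\<Sum>n<N. (cmod (c n))\<^sup>2) \<le> integral {0..2*pi} (\<lambda>\<theta>. (cmod (f (cis \<theta>)))\<^sup>2)"
proof -
  define E where "E = 2 * pi * (\<Sum>n<N. (cmod (c n))\<^sup>2)"
  define s where "s \<theta> = (\<Sum>n<N. c n * cis \<theta> ^ n)" for \<theta>
  have fs: "((\<lambda>\<theta>. f (cis \<theta>) * cnj (s \<theta>)) has_integral of_real E) {0..2*pi}"
    unfolding s_def E_def by (rule inner_product_with_partial_sum[OF assms])
  have "(\<lambda>n. (if n < N then c n else 0) * z ^ n) sums (\<Sum>n<N. c n * z ^ n)" for z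
    using sums_finite[of "{..<N}" "\<lambda>n. (if n < N then c n else 0) * z ^ n"] by simp
  from inner_product_with_partial_sum[OF \<open>1 < R\<close> this, of N]
  have ss: "((\<lambda>\<theta>. s \<theta> * cnj (s \<theta>)) has_integral of_real E) {0..2*pi}"
    by (simp add: s_def E_def)
  have cont: "continuous_on {0..2*pi} (\<lambda>\<theta>. f (cis \<theta>))"
    by (rule continuous_on_compose2[OF holomorphic_on_imp_continuous_on[OF power_series_holomorphic_ball[OF S]]])
       (use \<open>1 < R\<close> in \<open>auto intro!: continuous_intros\<close>)
  have "((\<lambda>\<theta>. 2 * Re (f (cis \<theta>) * cnj (s \<theta>)) - Re (s \<theta> * cnj (s \<theta>))) has_integral (2 * E - E)) {0..2*pi}"
    using has_integral_linear[OF fs bounded_linear_Re] has_integral_linear[OF ss bounded_linear_Re]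
    by (intro has_integral_diff has_integral_mult_right) (simp_all add: o_def)
  moreover have "((\<lambda>\<theta>. (cmod (f (cis \<theta>)))\<^sup>2) has_integral integral {0..2*pi} (\<lambda>\<theta>. (cmod (f (cis \<theta>)))\<^sup>2)) {0..2*pi}"
    by (intro integrable_integral integrable_continuous_interval continuous_intros cont)
  moreover have "2 * Re (w * cnj v) - Re (v * cnj v) \<le> (cmod w)\<^sup>2" for v w
    using zero_le_power2[of "cmod (w - v)"]
    by (simp only: cmod_power2) (simp add: power2_eq_square algebra_simps)
  ultimately have "2 * E - E \<le> integral {0..2*pi} (\<lambda>\<theta>. (cmod (f (cis \<theta>)))\<^sup>2)"
    by (rule has_integral_le)
  thus ?thesis by (simp add: E_def)
qed

section \<open>Splitting a function into two square-integrable factors\<close>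

text \<open>
  Conjugation is inversion on the unit circle, so \<open>p \<cdot> cnj q\<close> is a Laurent polynomial there, and
  reflecting its negative powers does not change the real part. The induction strips one factor \<open>z\<close>
  from both polynomials at once, since \<open>z \<cdot> cnj z = 1\<close>.
\<close>

lemma cnj_poly_mult_on_circle:
  fixes p q :: "complex poly"
  shows "\<exists>r. \<forall>z\<in>sphere 0 1. Re (poly p z * cnj (poly q z)) = Re (poly r z)"
proof (induction p arbitrary: q)
  case 0
  show ?case by (rule exI[of _ 0]) simp
next
  case (pCons a p)
  obtain b q' where q: "q = pCons b q'" by (cases q)
  obtain r where r: "\<And>z. z \<in> sphere 0 1 \<Longrightarrow> Re (poly p z * cnj (poly q' z)) = Re (poly r z)"
    using pCons.IH[of q'] by blast
  have "Re (poly (pCons a p) z * cnj (poly q z))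
      = Re (poly (smult (cnj b) (pCons a p) + smult (cnj a) (pCons 0 q') + r) z)"
    if z: "z \<in> sphere 0 1" for z
  proof -
    have "z * cnj z = 1" using z by (simp add: complex_norm_square[symmetric])
    hence "(a + z * P) * cnj (b + z * Q) = cnj b * (a + z * P) + a * cnj (z * Q) + P * cnj Q" for P Q
      by (simp add: algebra_simps)
    from this[of "poly p z" "poly q' z"]
    have "Re (poly (pCons a p) z * cnj (poly q z))
        = Re (cnj b * poly (pCons a p) z) + Re (a * cnj (z * poly q' z)) + Re (poly p z * cnj (poly q' z))"
      by (simp only: q poly_pCons plus_complex.simps)
    moreover have "Re (a * cnj w) = Re (cnj a * w)" for w by simp
    ultimately show ?thesis by (simp only: r[OF z] poly_add poly_smult plus_complex.simps poly_pCons add_0)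
  qed
  thus ?case by blast
qed

text \<open>
  Real parts of polynomials, as functions on the circle, are the real trigonometric polynomials;
  they form an algebra because \<open>2 Re p Re q = Re (p q) + Re (p \<cdot> cnj q)\<close>, so the theorem of Stone and
  Weierstrass applies.
\<close>

lemma Re_poly_dense_on_circle:
  fixes \<phi> :: "complex \<Rightarrow> real"
  assumes "continuous_on (sphere 0 1) \<phi>" and "0 < e"
  obtains h :: "complex poly" where "\<And>z. z \<in> sphere 0 1 \<Longrightarrow> \<bar>\<phi> z - Re (poly h z)\<bar> < e"
proof -
  define R where "R = {\<psi> :: complex \<Rightarrow> real. \<exists>p. \<forall>z\<in>sphere 0 1. \<psi> z = Re (poly p z)}"
  interpret function_ring_on R "sphere 0 1 :: complex set"
  proof
    show "compact (sphere 0 1 :: complex set)" by simp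
  next
    fix f assume "f \<in> R"
    then obtain p where p: "\<And>z. z \<in> sphere 0 1 \<Longrightarrow> f z = Re (poly p z)" by (auto simp: R_def)
    have "continuous_on (sphere 0 1) (\<lambda>z. Re (poly p z))" by (intro continuous_intros)
    thus "continuous_on (sphere 0 1) f" using p by (subst continuous_on_cong[OF refl p]) simp_all
  next
    fix f g assume "f \<in> R" "g \<in> R"
    then obtain p q where pq: "\<And>z. z \<in> sphere 0 1 \<Longrightarrow> f z = Re (poly p z)"
       "\<And>z. z \<in> sphere 0 1 \<Longrightarrow> g z = Re (poly q z)" by (auto simp: R_def)
    show "(\<lambda>x. f x + g x) \<in> R" using pq by (auto simp: R_def intro!: exI[of _ "p + q"])
    obtain r where r: "\<And>z. z \<in> sphere 0 1 \<Longrightarrow> Re (poly p z * cnj (poly q z)) = Re (poly r z)"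
      using cnj_poly_mult_on_circle[of p q] by blast
    have "f z * g z = Re (poly (smult (1/2) (p * q + r)) z)" if "z \<in> sphere 0 1" for z
      using pq[OF that] r[OF that] by (simp add: field_simps)
    thus "(\<lambda>x. f x * g x) \<in> R" unfolding R_def by blast
  next
    fix c :: real
    show "(\<lambda>_. c) \<in> R" by (auto simp: R_def intro!: exI[of _ "[:of_real c:]"])
  next
    fix x y :: complex assume "x \<noteq> y"
    have "Re \<in> R" by (auto simp: R_def intro!: exI[of _ "[:0, 1:]"])
    moreover have "Im \<in> R" by (auto simp: R_def intro!: exI[of _ "[:0, -\<i>:]"])
    ultimately show "\<exists>f\<in>R. f x \<noteq> f y" using \<open>x \<noteq> y\<close> by (metis complex_eq_iff)
  qed
  obtain g where "g \<in> R" "\<forall>z\<in>sphere 0 1. \<bar>\<phi> z - g z\<bar> < e"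
    using Stone_Weierstrass_basic[OF assms] by blast
  moreover from \<open>g \<in> R\<close> obtain p where "\<forall>z\<in>sphere 0 1. g z = Re (poly p z)" by (auto simp: R_def)
  ultimately show thesis using that[of p] by simp
qed

text \<open>
  A substitute for the factorization of an \<open>H\<^sup>1\<close> function into two \<open>H\<^sup>2\<close> functions that avoids
  Blaschke products and square roots. An outer function \<open>u\<close> with \<open>|u|\<^sup>2 = |f| + 1\<close> on the circle would
  give the factors \<open>u\<close> and \<open>f / u\<close>; here \<open>u = exp h\<close> for a polynomial \<open>h\<close> whose real part approximates
  \<open>log (|f| + 1) / 2\<close>. The summand 1 keeps the logarithm continuous at the zeros of \<open>f\<close>, and an
  approximation error of at most 1/2 costs the factor \<open>exp 1\<close>.
\<close>

lemma factor_on_circle: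
  fixes f :: "complex \<Rightarrow> complex"
  assumes "1 < R" and hol: "f holomorphic_on ball 0 R"
  obtains u t where "u holomorphic_on ball 0 R" "t holomorphic_on ball 0 R" "\<And>z. f z = u z * t z"
    "\<And>z. z \<in> sphere 0 1 \<Longrightarrow> (cmod (u z))\<^sup>2 \<le> exp 1 * (cmod (f z) + 1)"
    "\<And>z. z \<in> sphere 0 1 \<Longrightarrow> (cmod (t z))\<^sup>2 \<le> exp 1 * cmod (f z)"
proof -
  define \<phi> where "\<phi> z = ln (cmod (f z) + 1) / 2" for z
  have pos: "0 < cmod w + 1" for w :: complex by (rule add_nonneg_pos) auto
  have "continuous_on (sphere 0 1) f"
    using holomorphic_on_imp_continuous_on[OF hol] by (rule continuous_on_subset) (use \<open>1 < R\<close> in auto)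
  hence "continuous_on (sphere 0 1) \<phi>"
    unfolding \<phi>_def using pos by (intro continuous_intros) (auto simp: less_imp_neq[symmetric])
  then obtain h :: "complex poly" where h: "\<And>z. z \<in> sphere 0 1 \<Longrightarrow> \<bar>\<phi> z - Re (poly h z)\<bar> < 1 / 2"
    using Re_poly_dense_on_circle[of \<phi> "1/2"] by auto
  define u where "u z = exp (poly h z)" for z
  define t where "t z = f z * exp (- poly h z)" for z
  have \<phi>: "exp (2 * \<phi> z) = cmod (f z) + 1" for z using pos[of "f z"] by (simp add: \<phi>_def)
  show thesis
  proof (rule that)
    show "u holomorphic_on ball 0 R" "t holomorphic_on ball 0 R"
      unfolding u_def t_def by (intro holomorphic_intros hol)+
    show "f z = u z * t z" for z
      by (simp add: u_def t_def exp_minus)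
  next
    fix z :: complex assume z: "z \<in> sphere 0 1"
    have hz: "Re (poly h z) < \<phi> z + 1 / 2" "\<phi> z - 1 / 2 < Re (poly h z)"
      using h[OF z] by linarith+
    have "(cmod (u z))\<^sup>2 = exp (2 * Re (poly h z))"
      by (simp add: u_def exp_double[symmetric] mult.commute)
    also have "\<dots> \<le> exp (1 + 2 * \<phi> z)" using hz by simp
    finally show "(cmod (u z))\<^sup>2 \<le> exp 1 * (cmod (f z) + 1)" by (simp add: exp_add \<phi>)
    have "(cmod (t z))\<^sup>2 = (cmod (f z))\<^sup>2 * exp (- (2 * Re (poly h z)))"
      by (simp add: t_def norm_mult power_mult_distrib exp_double[symmetric] mult.commute)
    also have "\<dots> \<le> (cmod (f z))\<^sup>2 * exp (1 - 2 * \<phi> z)"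
      using hz by (intro mult_left_mono) auto
    also have "\<dots> = exp 1 * ((cmod (f z))\<^sup>2 / (cmod (f z) + 1))" by (simp add: exp_diff \<phi>)
    also have "\<dots> \<le> exp 1 * cmod (f z)"
      using pos[of "f z"] by (intro mult_left_mono) (auto simp: divide_le_eq power2_eq_square algebra_simps)
    finally show "(cmod (t z))\<^sup>2 \<le> exp 1 * cmod (f z)" .
  qed
qed

section \<open>Hilbert's and Hardy's inequalities\<close>

text \<open>
  In place of the integral comparison with \<open>2 arctan (sqrt (x / m))\<close>, which is a primitive of
  \<open>sqrt m / (sqrt x (m + x))\<close>, the algebraic primitive \<open>- 8 sqrt m / (sqrt x + sqrt m)\<close> of a function of
  the same size allows the sum to telescope.
\<close>

lemma telescoping_kernel_step:
  fixes x m :: real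
  assumes "0 \<le> x" "1 \<le> m"
  shows "sqrt m / (sqrt (x + 1) * (m + x))
    \<le> 8 * sqrt m / (sqrt x + sqrt m) - 8 * sqrt m / (sqrt (x + 1) + sqrt m)"
proof -
  define p q s where "p = sqrt x" and "q = sqrt (x + 1)" and "s = sqrt m"
  have sq: "p^2 = x" "q^2 = x + 1" "s^2 = m" using assms by (auto simp: p_def q_def s_def)
  have pos: "0 \<le> p" "0 < q" "0 < s" "p \<le> q" using assms by (auto simp: p_def q_def s_def)
  have "(p + s) * (q + s) \<le> (q + s) * (q + s)" using pos by (intro mult_right_mono) auto
  also have "\<dots> \<le> 2 * (q^2 + s^2)"
    using sum_squares_bound[of q s] by (simp add: power2_eq_square algebra_simps)
  also have "\<dots> \<le> 4 * (m + x)" using sq assms by simp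
  finally have 1: "(p + s) * (q + s) \<le> 4 * (m + x)" .
  have "(q - p) * (q + p) = 1" using sq by (simp add: power2_eq_square algebra_simps)
  moreover have "(q - p) * (q + p) \<le> (q - p) * (2 * q)" using pos by (intro mult_left_mono) auto
  ultimately have 2: "1 \<le> 2 * q * (q - p)" by (simp add: algebra_simps)
  have "((p + s) * (q + s)) * 1 \<le> (4 * (m + x)) * (2 * q * (q - p))"
    by (rule mult_mono[OF 1 2]) (use assms in auto)
  hence "s * ((p + s) * (q + s)) \<le> s * (8 * (q - p) * (q * (m + x)))"
    using pos by (intro mult_left_mono) (auto simp: algebra_simps)
  hence "s / (q * (m + x)) \<le> 8 * s * (q - p) / ((p + s) * (q + s))"
    using pos assms by (simp add: divide_le_eq pos_le_divide_eq) (simp add: field_simps)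
  also have "\<dots> = 8 * s / (p + s) - 8 * s / (q + s)"
    using pos by (simp add: field_simps)
  finally show ?thesis by (simp add: p_def q_def s_def)
qed

lemma hilbert_kernel_row_sum:
  fixes i N :: nat
  shows "(\<Sum>j<N. sqrt (real (Suc i)) / (sqrt (real (Suc j)) * real (i + j + 1))) \<le> 8"
proof -
  define \<psi> where "\<psi> j = 8 * sqrt (real (Suc i)) / (sqrt (real j) + sqrt (real (Suc i)))" for j
  have "(\<Sum>j<N. sqrt (real (Suc i)) / (sqrt (real (Suc j)) * real (i + j + 1))) \<le> (\<Sum>j<N. \<psi> j - \<psi> (Suc j))"
    using telescoping_kernel_step[of "real j" "real (Suc i)" for j]
    by (intro sum_mono) (simp add: \<psi>_def algebra_simps)
  also have "\<dots> = \<psi> 0 - \<psi> N" by (rule sum_lessThan_telescope')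
  also have "\<dots> \<le> 8" by (simp add: \<psi>_def)
  finally show ?thesis .
qed

text \<open>
  Schur's test for the kernel \<open>1 / (i + j + 1)\<close> with weights \<open>sqrt (i + 1)\<close>: each product \<open>x i * y j\<close>
  is split by the inequality between the arithmetic and the geometric mean so that both rows and
  columns have bounded sums.
\<close>

lemma hilbert_inequality:
  fixes x y :: "nat \<Rightarrow> real"
  assumes X: "\<And>N. (\<Sum>i<N. (x i)\<^sup>2) \<le> X" and Y: "\<And>N. (\<Sum>i<N. (y i)\<^sup>2) \<le> Y"
    and nn: "\<And>i. 0 \<le> x i" "\<And>i. 0 \<le> y i"
  shows "(\<Sum>n<N. (\<Sum>i\<le>n. x i * y (n - i)) / real (Suc n)) \<le> 4 * (X + Y)"
proof -
  define w where "w i j = sqrt (real (Suc i)) / (sqrt (real (Suc j)) * real (i + j + 1))" for i j :: nat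
  have w0: "0 \<le> w i j" for i j by (simp add: w_def)
  have row: "(\<Sum>j<N. w i j) \<le> 8" for i using hilbert_kernel_row_sum[of i N] by (simp add: w_def)
  have summand: "x i * y j / real (i + j + 1) \<le> ((x i)\<^sup>2 * w i j + (y j)\<^sup>2 * w j i) / 2" for i j
  proof -
    define a b where "a = sqrt (real (Suc i))" and "b = sqrt (real (Suc j))"
    have ab: "0 < a" "0 < b" by (auto simp: a_def b_def)
    have "0 \<le> (x i * a - y j * b)\<^sup>2 / (a * b)" using ab by simp
    also have "\<dots> = (x i)\<^sup>2 * (a / b) + (y j)\<^sup>2 * (b / a) - 2 * (x i * y j)"
      using ab by (simp add: power2_eq_square field_simps)
    finally have "2 * (x i * y j) \<le> (x i)\<^sup>2 * (a / b) + (y j)\<^sup>2 * (b / a)" by simp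
    moreover have "p \<le> q / 2" if "2 * p \<le> q" for p q :: real using that by simp
    ultimately have "x i * y j \<le> ((x i)\<^sup>2 * (a / b) + (y j)\<^sup>2 * (b / a)) / 2" by blast
    hence "x i * y j / real (i + j + 1) \<le> ((x i)\<^sup>2 * (a / b) + (y j)\<^sup>2 * (b / a)) / 2 / real (i + j + 1)"
      by (intro divide_right_mono) auto
    also have "\<dots> = ((x i)\<^sup>2 * (a / b) + (y j)\<^sup>2 * (b / a)) / real (i + j + 1) / 2"
      by (simp only: divide_divide_eq_left mult.commute)
    also have "\<dots> = ((x i)\<^sup>2 * w i j + (y j)\<^sup>2 * w j i) / 2"
      unfolding w_def a_def [symmetric] b_def [symmetric]
      by (simp only: times_divide_eq_right divide_divide_eq_left add_divide_distrib add.commute [of j i])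
    finally show ?thesis .
  qed
  have "(\<Sum>n<N. (\<Sum>i\<le>n. x i * y (n - i)) / real (Suc n))
      = (\<Sum>n<N. \<Sum>i\<le>n. x i * y (n - i) / real (i + (n - i) + 1))"
    by (simp add: sum_divide_distrib)
  also have "\<dots> = (\<Sum>(i,j)\<in>{(i,j). i + j < N}. x i * y j / real (i + j + 1))"
    by (subst sum.triangle_reindex) simp
  also have "\<dots> \<le> (\<Sum>(i,j)\<in>{..<N} \<times> {..<N}. x i * y j / real (i + j + 1))"
    using nn by (intro sum_mono2) auto
  also have "\<dots> \<le> (\<Sum>(i,j)\<in>{..<N} \<times> {..<N}. ((x i)\<^sup>2 * w i j + (y j)\<^sup>2 * w j i) / 2)"
    using summand by (intro sum_mono) auto
  also have "\<dots> = ((\<Sum>i<N. \<Sum>j<N. (x i)\<^sup>2 * w i j) + (\<Sum>i<N. \<Sum>j<N. (y j)\<^sup>2 * w j i)) / 2"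
    by (simp add: sum.cartesian_product[symmetric] sum_divide_distrib[symmetric] sum.distrib)
  also have "(\<Sum>i<N. \<Sum>j<N. (y j)\<^sup>2 * w j i) = (\<Sum>j<N. \<Sum>i<N. (y j)\<^sup>2 * w j i)"
    by (rule sum.swap)
  also have "(\<Sum>i<N. \<Sum>j<N. (x i)\<^sup>2 * w i j) \<le> (\<Sum>i<N. (x i)\<^sup>2 * 8)"
    unfolding sum_distrib_left[symmetric] by (intro sum_mono mult_left_mono row) auto
  also have "(\<Sum>j<N. \<Sum>i<N. (y j)\<^sup>2 * w j i) \<le> (\<Sum>j<N. (y j)\<^sup>2 * 8)"
    unfolding sum_distrib_left[symmetric] by (intro sum_mono mult_left_mono row) auto
  finally show ?thesis using X[of N] Y[of N] by (simp add: sum_distrib_right[symmetric])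
qed

text \<open>
  With \<open>f = u t\<close> from the factorization, the coefficients of \<open>f\<close> are the Cauchy products of those of
  \<open>u\<close> and \<open>t\<close>, whose absolute values are square summable by Bessel's inequality; Hilbert's inequality
  then bounds the weighted sum.
\<close>

lemma hardy_inequality:
  fixes f :: "complex \<Rightarrow> complex"
  assumes "1 < R" and S: "\<And>z. z \<in> ball 0 R \<Longrightarrow> (\<lambda>n. c n * z ^ n) sums f z"
  shows "(\<Sum>n<N. cmod (c n) / real (Suc n))
    \<le> 4 * exp 1 * (2 * (1 / (2 * pi) * integral {0..2*pi} (\<lambda>\<theta>. cmod (f (cis \<theta>)))) + 1)"
proof -
  have hol: "f holomorphic_on ball 0 R" using S by (rule power_series_holomorphic_ball)
  obtain u t where u: "u holomorphic_on ball 0 R" and t: "t holomorphic_on ball 0 R"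
    and fut: "\<And>z. f z = u z * t z"
    and ub: "\<And>z. z \<in> sphere 0 1 \<Longrightarrow> (cmod (u z))\<^sup>2 \<le> exp 1 * (cmod (f z) + 1)"
    and tb: "\<And>z. z \<in> sphere 0 1 \<Longrightarrow> (cmod (t z))\<^sup>2 \<le> exp 1 * cmod (f z)"
    using factor_on_circle[OF \<open>1 < R\<close> hol] by metis
  define b d where "b n = (deriv ^^ n) u 0 / fact n" and "d n = (deriv ^^ n) t 0 / fact n" for n
  have bs: "(\<lambda>n. b n * z ^ n) sums u z" and ds: "(\<lambda>n. d n * z ^ n) sums t z" if "z \<in> ball 0 R" for z
    using holomorphic_power_series[OF u that] holomorphic_power_series[OF t that] by (simp_all add: b_def d_def)
  have c: "c n = (\<Sum>i\<le>n. b i * d (n - i))" for n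
  proof -
    have fps: "F has_fps_expansion Abs_fps a" if "\<And>z. z \<in> ball 0 R \<Longrightarrow> (\<lambda>n. a n * z ^ n) sums F z"
      for F :: "complex \<Rightarrow> complex" and a
      using that \<open>1 < R\<close>
      by (intro has_fps_expansionI eventually_nhds_in_open[THEN eventually_mono, of "ball 0 R"]) auto
    have "f has_fps_expansion Abs_fps b * Abs_fps d"
      using has_fps_expansion_mult[OF fps[OF bs] fps[OF ds]] by (simp add: fut[abs_def])
    with fps[OF S] have "Abs_fps c = Abs_fps b * Abs_fps d" by (rule fps_expansion_unique_complex)
    hence "fps_nth (Abs_fps c) n = fps_nth (Abs_fps b * Abs_fps d) n" by simp
    thus ?thesis by (simp add: fps_mult_nth atLeast0AtMost)
  qed
  define I where "I = integral {0..2*pi} (\<lambda>\<theta>. cmod (f (cis \<theta>)))"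
  have cont: "continuous_on {0..2*pi} (\<lambda>\<theta>. F (cis \<theta>))" if "F holomorphic_on ball 0 R" for F :: "complex \<Rightarrow> complex"
    by (rule continuous_on_compose2[OF holomorphic_on_imp_continuous_on[OF that]])
       (use \<open>1 < R\<close> in \<open>auto intro!: continuous_intros\<close>)
  have int: "(\<lambda>\<theta>. (cmod (F (cis \<theta>)))\<^sup>2) integrable_on {0..2*pi}" "(\<lambda>\<theta>. cmod (F (cis \<theta>))) integrable_on {0..2*pi}"
    if "F holomorphic_on ball 0 R" for F :: "complex \<Rightarrow> complex"
    by (intro integrable_continuous_interval continuous_intros cont[OF that])+
  have fI: "((\<lambda>\<theta>. cmod (f (cis \<theta>))) has_integral I) {0..2*pi}"
    unfolding I_def by (intro integrable_integral int hol)
  have "((\<lambda>\<theta>. exp 1 * (cmod (f (cis \<theta>)) + 1)) has_integral exp 1 * (I + 2 * pi)) {0..2*pi}"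
    using has_integral_const_real[of "1::real" 0 "2*pi"]
    by (intro has_integral_mult_right has_integral_add fI) simp
  with integrable_integral[OF int(1)[OF u]]
  have U: "integral {0..2*pi} (\<lambda>\<theta>. (cmod (u (cis \<theta>)))\<^sup>2) \<le> exp 1 * (I + 2 * pi)"
    by (rule has_integral_le) (simp add: ub)
  have T: "integral {0..2*pi} (\<lambda>\<theta>. (cmod (t (cis \<theta>)))\<^sup>2) \<le> exp 1 * I"
    by (rule has_integral_le[OF integrable_integral[OF int(1)[OF t]] has_integral_mult_right[OF fI]]) (simp add: tb)
  have "(\<Sum>n<N. cmod (c n) / real (Suc n)) \<le> (\<Sum>n<N. (\<Sum>i\<le>n. cmod (b i) * cmod (d (n - i))) / real (Suc n))"
    unfolding c norm_mult[symmetric] by (intro sum_mono divide_right_mono norm_sum) auto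
  also have "\<dots> \<le> 4 * (exp 1 * (I + 2 * pi) / (2 * pi) + exp 1 * I / (2 * pi))"
  proof (rule hilbert_inequality)
    show "(\<Sum>i<N. (cmod (b i))\<^sup>2) \<le> exp 1 * (I + 2 * pi) / (2 * pi)" for N
      using bessel_inequality_circle[OF \<open>1 < R\<close> bs, of N] U by (simp add: field_simps)
    show "(\<Sum>i<N. (cmod (d i))\<^sup>2) \<le> exp 1 * I / (2 * pi)" for N
      using bessel_inequality_circle[OF \<open>1 < R\<close> ds, of N] T by (simp add: field_simps)
  qed auto
  also have "\<dots> = 4 * exp 1 * (2 * (1 / (2 * pi) * I) + 1)" by (simp add: field_simps)
  finally show ?thesis by (simp only: I_def)
qed

section \<open>Derivatives in the Hardy space and absolutely summable coefficients\<close>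

lemma hardy_1E:
  assumes "f \<in> hardy_1"
  obtains M where "f holomorphic_on unit_disk"
    "\<And>r. 0 \<le> r \<Longrightarrow> r < 1 \<Longrightarrow> 1 / (2*pi) * integral {0..2*pi} (\<lambda>\<theta>. cmod (f (of_real r * cis \<theta>))) \<le> M"
  using assms unfolding hardy_1_def bdd_above_def by fastforce

text \<open>
  Hardy's inequality is applied to the dilations of \<open>deriv g\<close>, which are holomorphic across the unit
  circle. Its bound does not depend on the radius, so it survives in the limit.
\<close>

lemma hardy_1_1_subset_ell_1: "hardy_1_1 \<subseteq> ell_1_disk"
proof
  fix g assume "g \<in> hardy_1_1"
  define f where "f = deriv g"
  define c where "c n = (deriv ^^ n) f 0 / fact n" for n
  define a where "a n = (deriv ^^ n) g 0 / fact n" for n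
  from \<open>g \<in> hardy_1_1\<close> have holg: "g holomorphic_on unit_disk" and "f \<in> hardy_1"
    by (auto simp: hardy_1_1_def f_def)
  from \<open>f \<in> hardy_1\<close> obtain M where hol: "f holomorphic_on unit_disk"
    and M: "\<And>r. 0 \<le> r \<Longrightarrow> r < 1 \<Longrightarrow> 1 / (2*pi) * integral {0..2*pi} (\<lambda>\<theta>. cmod (f (of_real r * cis \<theta>))) \<le> M"
    using hardy_1E by blast
  have ac: "cmod (a (Suc n)) = cmod (c n) / real (Suc n)" for n
    by (simp add: a_def c_def f_def funpow_swap1 norm_divide norm_mult field_simps del: of_nat_Suc)
  define K where "K = 4 * exp 1 * (2 * M + 1)"
  have le: "(\<Sum>n<N. cmod (c n) * r ^ n / real (Suc n)) \<le> K" if r: "0 < r" "r < 1" for N r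
  proof -
    have "(\<Sum>n<N. cmod (c n * of_real r ^ n) / real (Suc n))
      \<le> 4 * exp 1 * (2 * (1 / (2 * pi) * integral {0..2*pi} (\<lambda>\<theta>. cmod (f (of_real r * cis \<theta>)))) + 1)"
      using r by (intro hardy_inequality[OF _ dilation_power_series[OF hol \<open>0 < r\<close>, folded c_def]]) auto
    also have "\<dots> \<le> K" unfolding K_def using M[of r] r by (intro mult_left_mono add_right_mono) auto
    finally show ?thesis using r by (simp add: norm_mult norm_power)
  qed
  have "(\<Sum>n<N. cmod (a (Suc n))) \<le> K" for N
  proof (rule tendsto_upperbound)
    show "((\<lambda>r. \<Sum>n<N. cmod (c n) * r ^ n / real (Suc n)) \<longlongrightarrow> (\<Sum>n<N. cmod (a (Suc n)))) (at_left (1::real))"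
      unfolding ac by (auto intro!: tendsto_eq_intros)
    show "\<forall>\<^sub>F r in at_left 1. (\<Sum>n<N. cmod (c n) * r ^ n / real (Suc n)) \<le> K"
      using eventually_at_left_real[OF zero_less_one] by eventually_elim (use le in \<open>auto simp del: of_nat_Suc\<close>)
  qed simp
  hence "summable (\<lambda>n. cmod (a (Suc n)))" by (intro summableI_nonneg_bounded) auto
  hence "summable (\<lambda>n. cmod (a n))" using summable_Suc_iff[of "\<lambda>n. cmod (a n)"] by blast
  moreover have "(\<lambda>n. a n * z ^ n) sums g z" if "z \<in> unit_disk" for z
    using holomorphic_power_series[OF holg that] by (simp add: a_def)
  ultimately show "g \<in> ell_1_disk" by (auto simp: ell_1_disk_def)
qed

text \<open>
  On the circle of radius \<open>r\<close> the integral formula for the \<open>n\<close>-th coefficient bounds it by the integral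
  mean divided by \<open>r ^ n\<close>.
\<close>

lemma hardy_1_coefficients_bounded:
  assumes "f \<in> hardy_1"
  shows "\<exists>M. \<forall>n. cmod ((deriv ^^ n) f 0 / fact n) \<le> M"
proof -
  define c where "c n = (deriv ^^ n) f 0 / fact n" for n
  from assms obtain M where hol: "f holomorphic_on unit_disk"
    and M: "\<And>r. 0 \<le> r \<Longrightarrow> r < 1 \<Longrightarrow> 1 / (2*pi) * integral {0..2*pi} (\<lambda>\<theta>. cmod (f (of_real r * cis \<theta>))) \<le> M"
    using hardy_1E by blast
  have le: "cmod (c n) * r ^ n \<le> M" if r: "0 < r" "r < 1" for n r
  proof -
    let ?f = "\<lambda>z. f (of_real r * z)"
    have R: "1 < 1 / r" using r by simp
    note S = dilation_power_series[OF hol \<open>0 < r\<close>, folded c_def]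
    have hol': "?f holomorphic_on ball 0 (1 / r)" using S by (rule power_series_holomorphic_ball)
    have cont: "continuous_on {0..2*pi} (\<lambda>\<theta>. ?f (cis \<theta>))"
      by (rule continuous_on_compose2[OF holomorphic_on_imp_continuous_on[OF hol']])
         (use R in \<open>auto intro!: continuous_intros\<close>)
    note I = circle_fourier_coefficient[OF R S, of n]
    have eq: "of_real (2 * pi) * (c n * of_real r ^ n)
        = integral {0..2*pi} (\<lambda>\<theta>. ?f (cis \<theta>) * cnj (cis (real n * \<theta>)))"
      by (rule integral_unique[OF I, symmetric])
    have "cmod (of_real (2 * pi) * (c n * of_real r ^ n)) \<le> integral {0..2*pi} (\<lambda>\<theta>. cmod (?f (cis \<theta>)))"
      unfolding eq
      by (intro integral_norm_bound_integral has_integral_integrable[OF I]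
            integrable_continuous_interval continuous_intros cont) (simp add: norm_mult)
    also have "\<dots> \<le> 2 * pi * M" using M[of r] r by (simp add: field_simps)
    finally show ?thesis using r by (simp add: norm_mult norm_power)
  qed
  have "cmod (c n) \<le> M" for n
  proof (rule tendsto_upperbound)
    show "((\<lambda>r. cmod (c n) * r ^ n) \<longlongrightarrow> cmod (c n)) (at_left (1::real))"
      by (auto intro!: tendsto_eq_intros)
    show "\<forall>\<^sub>F r in at_left 1. cmod (c n) * r ^ n \<le> M"
      using eventually_at_left_real[OF zero_less_one] by eventually_elim (auto intro: le)
  qed simp
  thus ?thesis unfolding c_def by blast
qed

text \<open>
  The function \<open>\<Sum>k. (3/4)^k z^(2^k)\<close> has summable coefficients, but differentiation turns the \<open>k\<close>-th of
  them into \<open>(3/2)^k\<close>.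
\<close>

lemma lacunary_ell_1_not_hardy_1_1: "\<exists>g. g \<in> ell_1_disk \<and> g \<notin> hardy_1_1"
proof -
  define p where "p k = (2::nat) ^ k" for k
  have mono: "strict_mono p" by (simp add: p_def strict_mono_def)
  hence inj: "inj p" by (rule strict_mono_imp_inj_on)
  define a :: "nat \<Rightarrow> complex" where "a n = (if n \<in> range p then (3/4) ^ (inv p n) else 0)" for n
  have ap: "a (p k) = (3/4) ^ k" for k by (simp add: a_def inv_f_f[OF inj])
  define g where "g z = (\<Sum>n. a n * z ^ n)" for z
  have "summable (\<lambda>k. cmod (a (p k)))" by (simp add: ap norm_power summable_geometric)
  hence sm: "summable (\<lambda>n. cmod (a n))"
    by (subst (asm) summable_mono_reindex[OF mono]) (auto simp: a_def)
  have S: "(\<lambda>n. a n * z ^ n) sums g z" if "z \<in> unit_disk" for z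
    unfolding g_def by (rule summable_norm_power_series[OF sm that])
  have "g \<in> ell_1_disk" using sm S by (auto simp: ell_1_disk_def)
  moreover have "g \<notin> hardy_1_1"
  proof
    assume "g \<in> hardy_1_1"
    hence "deriv g \<in> hardy_1" by (simp add: hardy_1_1_def)
    then obtain M where M: "\<And>n. cmod ((deriv ^^ n) (deriv g) 0 / fact n) \<le> M"
      using hardy_1_coefficients_bounded by blast
    have "(3/2) ^ k \<le> M" for k :: nat
    proof -
      obtain n where n: "p k = Suc n" by (metis p_def not0_implies_Suc power_not_zero zero_neq_numeral)
      have "(deriv ^^ n) (deriv g) 0 / fact n = of_nat (Suc n) * a (Suc n)"
        by (rule deriv_coefficient[OF zero_less_one S])
      hence "cmod (of_nat (p k) * a (p k)) \<le> M" using M[of n] n by simp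
      also have "cmod (of_nat (p k) * a (p k)) = (2 * (3/4)) ^ k"
        unfolding ap norm_mult power_mult_distrib by (simp add: p_def norm_power norm_divide)
      finally show ?thesis by simp
    qed
    moreover obtain k where "M < (3/2) ^ k" using real_arch_pow[of "3/2" M] by auto
    ultimately show False by (meson not_less)
  qed
  ultimately show ?thesis by blast
qed

section \<open>Majorants that are uniformly integrable on radii\<close>

text \<open>
  By the Weierstrass test \<open>\<Sum>k. b k * x ^ Suc (m k)\<close> is continuous on the closed interval, in particular
  at the end point 1.
\<close>

lemma power_tail_sum_small:
  fixes b :: "nat \<Rightarrow> real"
  assumes b: "summable b" "\<And>k. 0 \<le> b k" and "0 < \<epsilon>"
  obtains r where "0 \<le> r" "r < 1" "(\<Sum>k. b k * (1 - r ^ Suc (m k))) \<le> \<epsilon>"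
    "summable (\<lambda>k. b k * (1 - r ^ Suc (m k)))"
proof -
  have bd: "\<bar>b k * x ^ Suc (m k)\<bar> \<le> b k" if "x \<in> {0..1}" for x k
    using b(2)[of k] that by (simp only: abs_mult abs_of_nonneg power_abs) 
      (intro mult_left_le power_le_one, auto)
  have sm: "summable (\<lambda>k. b k * x ^ Suc (m k))" if "x \<in> {0..1}" for x
    by (rule summable_comparison_test'[OF b(1)]) (use bd[OF that] in simp)
  define B where "B x = (\<Sum>k. b k * x ^ Suc (m k))" for x
  have "continuous_on {0..1} B"
    unfolding B_def
  proof (rule uniform_limit_theorem[OF always_eventually])
    show "uniform_limit {0..1} (\<lambda>n x. \<Sum>k<n. b k * x ^ Suc (m k)) (\<lambda>x. \<Sum>k. b k * x ^ Suc (m k)) sequentially"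
      using bd b(1) by (intro Weierstrass_m_test) auto
  qed (auto intro!: continuous_intros)
  then obtain d where "0 < d" and d: "\<And>x. x \<in> {0..1} \<Longrightarrow> dist x 1 < d \<Longrightarrow> dist (B x) (B 1) < \<epsilon>"
    using \<open>0 < \<epsilon>\<close> unfolding continuous_on_iff by (meson atLeastAtMost_iff order_refl zero_le_one)
  define r where "r = max 0 (1 - d / 2)"
  have r: "0 \<le> r" "r < 1" "dist r 1 < d" using \<open>0 < d\<close> by (auto simp: r_def dist_real_def)
  have "(\<lambda>k. b k * 1 ^ Suc (m k) - b k * r ^ Suc (m k)) sums (B 1 - B r)"
    unfolding B_def using r by (intro sums_diff summable_sums sm) auto
  hence *: "(\<lambda>k. b k * (1 - r ^ Suc (m k))) sums (B 1 - B r)" by (simp add: algebra_simps)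
  have "B 1 - B r \<le> \<epsilon>" using d[of r] r by (auto simp: dist_real_def abs_less_iff)
  with * r show thesis using that[of r] by (auto simp: sums_iff)
qed

text \<open>
  Passing to extended reals allows the majorizing series to be used before anything is known about
  its convergence.
\<close>

lemma ennreal_norm_limit_le_suminf:
  fixes S :: "nat \<Rightarrow> 'a::real_normed_vector"
  assumes lim: "S \<longlonglongrightarrow> L" and le: "\<And>N. norm (S N) \<le> (\<Sum>k\<le>N. t k)" and t: "\<And>k. 0 \<le> t k"
  shows "ennreal (norm L) \<le> (\<Sum>k. ennreal (t k))"
proof (rule LIMSEQ_le_const2)
  show "(\<lambda>N. ennreal (norm (S N))) \<longlonglongrightarrow> ennreal (norm L)"
    by (intro tendsto_ennrealI tendsto_norm lim)
  have "ennreal (norm (S N)) \<le> (\<Sum>k. ennreal (t k))" for N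
  proof -
    have "ennreal (norm (S N)) \<le> ennreal (\<Sum>k\<le>N. t k)" by (intro ennreal_leI le)
    also have "\<dots> = (\<Sum>k\<le>N. ennreal (t k))" using t by simp
    also have "\<dots> \<le> (\<Sum>k. ennreal (t k))" by (intro sum_le_suminf) auto
    finally show ?thesis .
  qed
  thus "\<exists>N0. \<forall>N\<ge>N0. ennreal (norm (S N)) \<le> (\<Sum>k. ennreal (t k))" by blast
qed

text \<open>
  The majorant depends on \<open>|z|\<close> only, hence is uniform in the angle, and its \<open>k\<close>-th term integrates over
  \<open>[r, 1)\<close> to \<open>b k * (1 - r ^ Suc (m k))\<close>. The exponents are arbitrary, so that the lemma applies to the
  power series of \<open>deriv g\<close> as well as to a dyadic grouping of it. In both cases \<open>S N z\<close> is a
  partial sum of the power series of \<open>deriv g\<close>.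
\<close>

lemma unif_integrable_radii_majorant:
  fixes b :: "nat \<Rightarrow> real" and m :: "nat \<Rightarrow> nat"
  assumes hol: "g holomorphic_on unit_disk" and b: "summable b" "\<And>k. 0 \<le> b k"
    and lim: "\<And>z. z \<in> unit_disk \<Longrightarrow> (\<lambda>N. S N z) \<longlonglongrightarrow> deriv g z"
    and le: "\<And>N z. z \<in> unit_disk \<Longrightarrow> cmod (S N z) \<le> (\<Sum>k\<le>N. b k * (real (Suc (m k)) * cmod z ^ m k))"
  shows "g \<in> unif_integrable_radii"
  unfolding unif_integrable_radii_def
proof (intro CollectI conjI hol allI impI)
  fix \<epsilon> :: real assume "0 < \<epsilon>"
  then obtain r where r: "0 \<le> r" "r < 1" "(\<Sum>k. b k * (1 - r ^ Suc (m k))) \<le> \<epsilon>"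
    and sm: "summable (\<lambda>k. b k * (1 - r ^ Suc (m k)))"
    using power_tail_sum_small[OF b, of \<epsilon> m] by metis
  have one: "(\<integral>\<^sup>+ t. ennreal (b k * (real (Suc (m k)) * t ^ m k)) * indicator {r..1} t \<partial>lborel)
      = ennreal (b k * (1 - r ^ Suc (m k)))" for k
  proof (rule nn_integral_has_integral_lebesgue')
    have "((\<lambda>t. real (Suc (m k)) * t ^ m k) has_integral (1 ^ Suc (m k) - r ^ Suc (m k))) {r..1}"
    proof (rule fundamental_theorem_of_calculus)
      show "((\<lambda>t. t ^ Suc (m k)) has_vector_derivative real (Suc (m k)) * t ^ m k) (at t within {r..1})" for t
        using DERIV_pow[of "Suc (m k)" t "{r..1}"]
        unfolding has_real_derivative_iff_has_vector_derivative by (simp only: diff_Suc_Suc diff_zero)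
    qed (use r in simp)
    thus "((\<lambda>t. b k * (real (Suc (m k)) * t ^ m k)) has_integral b k * (1 - r ^ Suc (m k))) {r..1}"
      by (intro has_integral_mult_right) simp
  qed (use b r in auto)
  have "(\<integral>\<^sup>+ t \<in> {r..<1}. ennreal (cmod (deriv g (of_real t * cis \<theta>))) \<partial>lborel) \<le> ennreal \<epsilon>" for \<theta>
  proof -
    have pt: "ennreal (cmod (deriv g (of_real t * cis \<theta>))) * indicator {r..<1} t
        \<le> (\<Sum>k. ennreal (b k * (real (Suc (m k)) * t ^ m k)) * indicator {r..1} t)" for t
    proof (cases "t \<in> {r..<1}")
      case True
      hence t: "of_real t * cis \<theta> \<in> unit_disk" "cmod (of_real t * cis \<theta>) = t" "0 \<le> t"
        using r by (auto simp: norm_mult)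
      have "ennreal (cmod (deriv g (of_real t * cis \<theta>))) \<le> (\<Sum>k. ennreal (b k * (real (Suc (m k)) * t ^ m k)))"
        using lim[OF t(1)] le[OF t(1)] b(2) t(3) unfolding t(2)
        by (intro ennreal_norm_limit_le_suminf[where S = "\<lambda>N. S N (of_real t * cis \<theta>)"]) auto
      thus ?thesis using True by simp
    qed simp
    have "(\<integral>\<^sup>+ t \<in> {r..<1}. ennreal (cmod (deriv g (of_real t * cis \<theta>))) \<partial>lborel)
        \<le> (\<integral>\<^sup>+ t. (\<Sum>k. ennreal (b k * (real (Suc (m k)) * t ^ m k)) * indicator {r..1} t) \<partial>lborel)"
      by (intro nn_integral_mono pt)
    also have "\<dots> = (\<Sum>k. ennreal (b k * (1 - r ^ Suc (m k))))"
      by (subst nn_integral_suminf) (simp_all add: one del: of_nat_Suc power_Suc)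
    also have "\<dots> = ennreal (\<Sum>k. b k * (1 - r ^ Suc (m k)))"
      using b(2) r by (intro suminf_ennreal2 sm mult_nonneg_nonneg) (auto intro!: power_le_one simp del: power_Suc)
    also have "\<dots> \<le> ennreal \<epsilon>" by (intro ennreal_leI r(3))
    finally show ?thesis .
  qed
  thus "\<exists>r. 0 \<le> r \<and> r < 1 \<and> (\<forall>\<theta>\<in>{0..<2*pi}.
      (\<integral>\<^sup>+ t \<in> {r..<1}. ennreal (cmod (deriv g (of_real t * cis \<theta>))) \<partial>lborel) \<le> ennreal \<epsilon>)"
    using r by blast
qed

lemma ell_1_subset_unif_integrable_radii: "ell_1_disk \<subseteq> unif_integrable_radii"
proof
  fix g assume "g \<in> ell_1_disk"
  then obtain a where sm: "summable (\<lambda>n. cmod (a n))"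
    and S: "\<And>z. z \<in> unit_disk \<Longrightarrow> (\<lambda>n. a n * z ^ n) sums g z"
    by (auto simp: ell_1_disk_def)
  show "g \<in> unif_integrable_radii"
  proof (rule unif_integrable_radii_majorant)
    show "g holomorphic_on unit_disk" using S by (rule power_series_holomorphic_ball)
    show "summable (\<lambda>n. cmod (a (Suc n)))" using sm summable_Suc_iff[of "\<lambda>n. cmod (a n)"] by blast
    show "(\<lambda>N. \<Sum>n<N. of_nat (Suc n) * a (Suc n) * z ^ n) \<longlonglongrightarrow> deriv g z" if "z \<in> unit_disk" for z
      using deriv_power_series[OF S that] by (simp only: sums_def)
    show "cmod (\<Sum>n<N. of_nat (Suc n) * a (Suc n) * z ^ n)
        \<le> (\<Sum>n\<le>N. cmod (a (Suc n)) * (real (Suc n) * cmod z ^ n))" for N z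
    proof -
      have "cmod (\<Sum>n<N. of_nat (Suc n) * a (Suc n) * z ^ n) \<le> (\<Sum>n<N. cmod (of_nat (Suc n) * a (Suc n) * z ^ n))"
        by (rule norm_sum)
      also have "\<dots> \<le> (\<Sum>n\<le>N. cmod (of_nat (Suc n) * a (Suc n) * z ^ n))" by (intro sum_mono2) auto
      finally show ?thesis by (simp add: norm_mult norm_power mult_ac del: of_nat_Suc)
    qed
  qed auto
qed

section \<open>Rudin-Shapiro polynomials\<close>

text \<open>
  Each step doubles the length of both polynomials by appending the second to the first with either
  sign; all coefficients are 1 or -1, while by the parallelogram law the sum of the squared absolute values on
  the disc only doubles as well.
\<close>

fun rudin_shapiro :: "nat \<Rightarrow> complex poly \<times> complex poly" where
  "rudin_shapiro 0 = (1, 1)"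
| "rudin_shapiro (Suc k) = (case rudin_shapiro k of (P, Q) \<Rightarrow>
     (P + monom 1 (2 ^ k) * Q, P - monom 1 (2 ^ k) * Q))"

definition rsP :: "nat \<Rightarrow> complex poly" where "rsP k = fst (rudin_shapiro k)"

definition rsQ :: "nat \<Rightarrow> complex poly" where "rsQ k = snd (rudin_shapiro k)"

lemma rs_simps:
  "rsP 0 = 1" "rsQ 0 = 1"
  "rsP (Suc k) = rsP k + monom 1 (2 ^ k) * rsQ k"
  "rsQ (Suc k) = rsP k - monom 1 (2 ^ k) * rsQ k"
  by (simp_all add: rsP_def rsQ_def split: prod.split)

lemma rs_coeff_eq_0: "2 ^ k \<le> n \<Longrightarrow> coeff (rsP k) n = 0 \<and> coeff (rsQ k) n = 0"
  by (induction k arbitrary: n) (simp_all add: rs_simps coeff_monom_mult)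

lemma rs_coeff_norm: "n < 2 ^ k \<Longrightarrow> norm (coeff (rsP k) n) = 1 \<and> norm (coeff (rsQ k) n) = 1"
proof (induction k arbitrary: n)
  case (Suc k)
  show ?case
  proof (cases "n < 2 ^ k")
    case True
    thus ?thesis using Suc.IH[of n] by (simp add: rs_simps coeff_monom_mult)
  next
    case False
    hence "n - 2 ^ k < 2 ^ k" using Suc.prems by simp
    thus ?thesis using Suc.IH[of "n - 2 ^ k"] rs_coeff_eq_0[of k n] False
      by (simp add: rs_simps coeff_monom_mult)
  qed
qed (simp add: rs_simps)

text \<open>
  The coefficients of \<open>rsP k\<close> stabilize as \<open>k\<close> grows; any \<open>k\<close> with \<open>n < 2 ^ k\<close> gives the \<open>n\<close>-th sign, and
  \<open>k = n\<close> is one.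
\<close>

definition rs_sign :: "nat \<Rightarrow> complex" where "rs_sign n = coeff (rsP n) n"

lemma rs_coeff_stable:
  assumes "k \<le> l" "n < 2 ^ k"
  shows "coeff (rsP l) n = coeff (rsP k) n"
  using assms(1)
proof (induction l rule: dec_induct)
  case (step l)
  have "n < 2 ^ l" using assms(2) power_increasing[OF step(1), of "2::nat"] by linarith
  thus ?case using step by (simp add: rs_simps coeff_monom_mult)
qed simp

lemma rs_sign_eq_coeff:
  assumes "n < 2 ^ k"
  shows "rs_sign n = coeff (rsP k) n"
proof (cases "k \<le> n")
  case True
  thus ?thesis using rs_coeff_stable[OF True assms] by (simp add: rs_sign_def)
next
  case False
  thus ?thesis using rs_coeff_stable[of n k n] by (simp add: rs_sign_def)
qed

lemma norm_rs_sign: "norm (rs_sign n) = 1"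
  using rs_coeff_norm[of n n] by (simp add: rs_sign_def)

lemma poly_rsP_eq_partial_sum: "poly (rsP k) z = (\<Sum>n<2 ^ k. rs_sign n * z ^ n)"
proof -
  have "poly (rsP k) z = (\<Sum>n\<le>degree (rsP k). coeff (rsP k) n * z ^ n)" by (rule poly_altdef)
  also have "\<dots> = (\<Sum>n<2 ^ k. coeff (rsP k) n * z ^ n)"
  proof (rule sum.mono_neutral_left)
    have "lead_coeff (rsP k) \<noteq> 0" using rs_coeff_norm[of 0 k] by auto
    hence "degree (rsP k) < 2 ^ k" using rs_coeff_eq_0[of k "degree (rsP k)"] by (meson not_le)
    thus "{..degree (rsP k)} \<subseteq> {..<2 ^ k}" by auto
  qed (auto simp: coeff_eq_0)
  finally show ?thesis by (simp add: rs_sign_eq_coeff)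
qed

text \<open>
  Both polynomials are estimated together because the parallelogram law controls only the sum of the
  squares of \<open>|p + q|\<close> and \<open>|p - q|\<close>.
\<close>

lemma rs_flat:
  assumes "cmod z \<le> 1"
  shows "(cmod (poly (rsP k) z))\<^sup>2 + (cmod (poly (rsQ k) z))\<^sup>2 \<le> 2 ^ Suc k"
proof (induction k)
  case (Suc k)
  define p q where "p = poly (rsP k) z" and "q = z ^ 2 ^ k * poly (rsQ k) z"
  have "(cmod (p + q))\<^sup>2 + (cmod (p - q))\<^sup>2 = 2 * ((cmod p)\<^sup>2 + (cmod q)\<^sup>2)"
    by (simp only: cmod_power2) (simp add: power2_eq_square algebra_simps)
  moreover have "(cmod q)\<^sup>2 \<le> (cmod (poly (rsQ k) z))\<^sup>2"
    using assms by (intro power_mono) (auto simp: q_def norm_mult norm_power mult_left_le_one_le power_le_one)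
  moreover have "a \<le> 2 * e" if "a = 2 * (b + c)" "c \<le> d" "b + d \<le> e" for a b c d e :: real
    using that by simp
  ultimately have "(cmod (p + q))\<^sup>2 + (cmod (p - q))\<^sup>2 \<le> 2 * 2 ^ Suc k"
    using Suc [folded p_def] by blast
  thus ?case by (simp add: rs_simps poly_monom p_def q_def)
qed (simp add: rs_simps)

lemma rs_flat_half:
  assumes "cmod z \<le> 1"
  shows "cmod (poly (rsQ k) z) \<le> sqrt 2 ^ Suc k"
proof -
  have "(cmod (poly (rsQ k) z))\<^sup>2 \<le> 2 ^ Suc k" using rs_flat[OF assms, of k] by (smt (verit) zero_le_power2)
  hence "cmod (poly (rsQ k) z) \<le> sqrt (2 ^ Suc k)" by (rule real_le_rsqrt)
  thus ?thesis by (simp only: real_sqrt_power)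
qed

text \<open>
  The block of degrees between \<open>2 ^ j\<close> and \<open>2 ^ Suc j\<close> is \<open>z ^ 2 ^ j * rsQ j\<close>. Its bound is written with
  the factor that \<open>unif_integrable_radii_majorant\<close> expects; the block with index \<open>j\<close> is the summand
  \<open>k = Suc j\<close>, and the truncated subtraction makes the summand \<open>k = 0\<close> equal to 1, the bound of the
  constant term.
\<close>

lemma rs_partial_sum_bound:
  assumes "cmod z < 1"
  shows "cmod (poly (rsP N) z) \<le> (\<Sum>k\<le>N. sqrt 2 ^ k / 2 ^ (k - 1) * (real (Suc (2 ^ (k - 1) - 1)) * cmod z ^ (2 ^ (k - 1) - 1)))"
proof (induction N)
  case (Suc N)
  have "cmod (poly (rsP (Suc N)) z) \<le> cmod (poly (rsP N) z) + cmod (poly (rsQ N) z) * cmod z ^ 2 ^ N"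
    by (simp add: rs_simps poly_monom norm_triangle_le norm_mult norm_power mult.commute)
  moreover have "cmod (poly (rsQ N) z) * cmod z ^ 2 ^ N \<le> sqrt 2 ^ Suc N * cmod z ^ (2 ^ N - 1)"
    using assms rs_flat_half[of z N] by (intro mult_mono power_decreasing) auto
  moreover have "sqrt 2 ^ Suc N / 2 ^ N * (real (Suc (2 ^ N - 1)) * cmod z ^ (2 ^ N - 1)) = sqrt 2 ^ Suc N * cmod z ^ (2 ^ N - 1)"
    by (simp add: of_nat_diff)
  ultimately show ?case using Suc by simp
qed (simp add: rs_simps)

text \<open>
  The witness is the primitive of \<open>\<Sum>n. rs_sign n * z ^ n\<close>. Its coefficients have the absolute values of
  the harmonic series, while cancellation within each dyadic block of the derivative gains a factor
  of order \<open>sqrt 2 ^ k\<close> over the triangle inequality, which makes the radial integrals converge.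
\<close>

lemma rudin_shapiro_unif_integrable_not_ell_1: "\<exists>g. g \<in> unif_integrable_radii \<and> g \<notin> ell_1_disk"
proof -
  (* Division by zero makes the constant term a 0 vanish. *)
  define a where "a n = rs_sign (n - 1) / of_nat n" for n
  have aS: "of_nat (Suc n) * a (Suc n) = rs_sign n" for n by (simp add: a_def del: of_nat_Suc)
  have a1: "cmod (a (Suc n)) = 1 / real (Suc n)" for n by (simp add: a_def norm_divide norm_rs_sign del: of_nat_Suc)
  have a_le: "cmod (a n) \<le> 1" for n by (cases n) (simp_all add: a1, simp add: a_def)
  define g where "g z = (\<Sum>n. a n * z ^ n)" for z
  have S: "(\<lambda>n. a n * z ^ n) sums g z" if z: "z \<in> unit_disk" for z
    unfolding g_def
  proof (rule summable_sums, rule summable_comparison_test')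
    show "summable (\<lambda>n. cmod z ^ n)" using z by (simp add: summable_geometric)
    show "norm (a n * z ^ n) \<le> cmod z ^ n" for n
      using a_le[of n] by (simp add: norm_mult norm_power mult_left_le_one_le)
  qed
  have "g \<in> unif_integrable_radii"
  proof (rule unif_integrable_radii_majorant[where m = "\<lambda>k. 2 ^ (k - 1) - 1"])
    show "g holomorphic_on unit_disk" using S by (rule power_series_holomorphic_ball)
    show "summable (\<lambda>k. sqrt 2 ^ k / 2 ^ (k - 1))"
    proof (rule summable_comparison_test')
      show "summable (\<lambda>k. 2 * (sqrt 2 / 2) ^ k)"
        by (intro summable_mult summable_geometric) (simp add: real_less_lsqrt)
      show "norm (sqrt 2 ^ k / 2 ^ (k - 1)) \<le> 2 * (sqrt 2 / 2) ^ k" for k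
        by (cases k) (simp_all add: power_divide)
    qed
    show "(\<lambda>N. poly (rsP N) z) \<longlonglongrightarrow> deriv g z" if "z \<in> unit_disk" for z
    proof -
      have "(\<lambda>N. \<Sum>n<N. rs_sign n * z ^ n) \<longlonglongrightarrow> deriv g z"
        using deriv_power_series[OF S that] unfolding aS sums_def .
      from LIMSEQ_subseq_LIMSEQ[OF this, of "\<lambda>k. 2 ^ k"] show ?thesis
        by (simp add: strict_mono_def o_def poly_rsP_eq_partial_sum)
    qed
    show "cmod (poly (rsP N) z) \<le> (\<Sum>k\<le>N. sqrt 2 ^ k / 2 ^ (k - 1) *
        (real (Suc (2 ^ (k - 1) - 1)) * cmod z ^ (2 ^ (k - 1) - 1)))" if "z \<in> unit_disk" for N z
      using rs_partial_sum_bound that by simp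
  qed auto
  moreover have "g \<notin> ell_1_disk"
  proof
    assume "g \<in> ell_1_disk"
    then obtain a' where sm: "summable (\<lambda>n. cmod (a' n))"
      and S': "\<And>z. z \<in> unit_disk \<Longrightarrow> (\<lambda>n. a' n * z ^ n) sums g z"
      by (auto simp: ell_1_disk_def)
    have "a' = a"
      using coeff_eq_higher_deriv[of 1 a' g, OF zero_less_one S'] coeff_eq_higher_deriv[of 1 a g, OF zero_less_one S]
      by (intro ext) simp
    hence "summable (\<lambda>n. cmod (a (Suc n)))" using sm summable_Suc_iff[of "\<lambda>n. cmod (a n)"] by simp
    hence "summable (\<lambda>n. inverse (real (Suc n)))" unfolding a1 by (simp add: inverse_eq_divide)
    thus False using summable_Suc_iff[of "\<lambda>n. inverse (real n)"] not_summable_harmonic[where 'a = real] by blast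
  qed
  ultimately show ?thesis by blast
qed

section \<open>Compactness of the integral operator\<close>

text \<open>
  A primitive exists because the disc is convex. It gives the holomorphy of \<open>volterra g f\<close> and allows the
  segment from the centre to be split in \<open>volterra_bound\<close>.
\<close>

lemma volterra_primitive:
  assumes g: "g holomorphic_on unit_disk" and f: "f holomorphic_on unit_disk"
  obtains F where "\<And>z. z \<in> unit_disk \<Longrightarrow> (F has_field_derivative f z * deriv g z) (at z)"
    "\<And>z. z \<in> unit_disk \<Longrightarrow> volterra g f z = F z - F 0"
proof -
  have "(\<lambda>t. f t * deriv g t) holomorphic_on unit_disk"
    using g f by (intro holomorphic_intros) auto
  then obtain F where F: "\<And>z. z \<in> unit_disk \<Longrightarrow> (F has_field_derivative f z * deriv g z) (at z within unit_disk)"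
    using holomorphic_convex_primitive'[OF convex_ball open_ball] by blast
  have "volterra g f z = F z - F 0" if "z \<in> unit_disk" for z
  proof -
    have "closed_segment 0 z \<subseteq> unit_disk" using that by (intro closed_segment_subset) auto
    hence "((\<lambda>t. f t * deriv g t) has_contour_integral (F (pathfinish (linepath 0 z)) - F (pathstart (linepath 0 z)))) (linepath 0 z)"
      by (intro contour_integral_primitive[OF F]) (simp_all only: valid_path_linepath path_image_linepath)
    thus ?thesis by (simp add: volterra_def contour_integral_unique)
  qed
  with F show thesis by (intro that[of F]) (auto simp: at_within_open[of _ unit_disk])
qed

text \<open>
  Both norms of \<open>f\<close> enter: on the small disc of radius \<open>r\<close>, where \<open>deriv g\<close> is bounded, only the supremum
  \<open>\<delta>\<close> of \<open>f\<close> on that disc matters, while on the rest of the radius the global bound \<open>M\<close> is multiplied by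
  the small integral of \<open>deriv g\<close>. This makes the operator continuous from locally uniform to uniform
  convergence on bounded sets.
\<close>

lemma volterra_bound:
  assumes g: "g holomorphic_on unit_disk" and f: "f holomorphic_on unit_disk"
    and M: "\<And>w. w \<in> unit_disk \<Longrightarrow> cmod (f w) \<le> M"
    and r: "0 \<le> r" "r < 1" and "0 \<le> \<delta>" "0 \<le> \<epsilon>"
    and \<delta>: "\<And>w. w \<in> cball 0 r \<Longrightarrow> cmod (f w) \<le> \<delta>"
    and B: "\<And>w. w \<in> cball 0 r \<Longrightarrow> cmod (deriv g w) \<le> B"
    and \<epsilon>: "\<And>\<theta>. \<theta> \<in> {0..<2*pi} \<Longrightarrow>
      (\<integral>\<^sup>+ t \<in> {r..<1}. ennreal (cmod (deriv g (of_real t * cis \<theta>))) \<partial>lborel) \<le> ennreal \<epsilon>"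
    and z: "z \<in> unit_disk"
  shows "cmod (volterra g f z) \<le> \<delta> * B + M * \<epsilon>"
proof -
  obtain F where F: "\<And>z. z \<in> unit_disk \<Longrightarrow> (F has_field_derivative f z * deriv g z) (at z)"
    and VF: "\<And>z. z \<in> unit_disk \<Longrightarrow> volterra g f z = F z - F 0"
    using volterra_primitive[OF g f] by metis
  have "0 \<le> M" using M[of 0] norm_ge_zero[of "f 0"] by (simp del: norm_ge_zero)
  have "0 \<le> B" using B[of 0] r norm_ge_zero[of "deriv g 0"] by (simp del: norm_ge_zero)
  have inner: "cmod (F w - F 0) \<le> \<delta> * B" if w: "w \<in> cball 0 r" for w
  proof -
    have "cmod (F w - F 0) \<le> \<delta> * B * cmod (w - 0)"
    proof (rule field_differentiable_bound[where S = "cball 0 r"])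
      show "(F has_field_derivative f x * deriv g x) (at x within cball 0 r)" if "x \<in> cball 0 r" for x
        using F[of x] that r by (auto intro: has_field_derivative_at_within)
      show "cmod (f x * deriv g x) \<le> \<delta> * B" if "x \<in> cball 0 r" for x
        unfolding norm_mult using that by (intro mult_mono \<delta> B \<open>0 \<le> \<delta>\<close>) auto
    qed (use w r in auto)
    also have "\<dots> \<le> \<delta> * B * 1"
      using w r \<open>0 \<le> \<delta>\<close> \<open>0 \<le> B\<close> by (intro mult_left_mono) auto
    finally show ?thesis by simp
  qed
  show ?thesis
  proof (cases "cmod z \<le> r")
    case True
    thus ?thesis using inner[of z] VF[OF z] \<open>0 \<le> M\<close> \<open>0 \<le> \<epsilon>\<close> by (auto intro: order_trans)
  next
    case False
    define \<rho> \<theta> where "\<rho> = cmod z" and "\<theta> = Arg2pi z"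
    have \<theta>: "\<theta> \<in> {0..<2*pi}" using Arg2pi[of z] by (auto simp: \<theta>_def)
    have z_polar: "z = of_real \<rho> * cis \<theta>"
      using Arg2pi_eq[of z] by (simp add: \<rho>_def \<theta>_def cis_conv_exp)
    have \<rho>: "r < \<rho>" "\<rho> < 1" using False z by (auto simp: \<rho>_def)
    define \<gamma> where "\<gamma> t = of_real t * cis \<theta>" for t :: real
    have \<gamma>: "\<gamma> t \<in> unit_disk" if "t \<in> {r..\<rho>}" for t
      using that r \<rho> by (auto simp: \<gamma>_def norm_mult)
    have \<gamma>': "(\<gamma> has_vector_derivative cis \<theta>) (at t within A)" for t A
      unfolding \<gamma>_def by (auto intro!: derivative_eq_intros)
    have "((\<lambda>t. cis \<theta> * (f (\<gamma> t) * deriv g (\<gamma> t))) has_integral (F (\<gamma> \<rho>) - F (\<gamma> r))) {r..\<rho>}"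
    proof (rule fundamental_theorem_of_calculus[where f = "\<lambda>t. F (\<gamma> t)"])
      show "((\<lambda>t. F (\<gamma> t)) has_vector_derivative cis \<theta> * (f (\<gamma> t) * deriv g (\<gamma> t))) (at t within {r..\<rho>})"
        if "t \<in> {r..\<rho>}" for t
        using field_vector_diff_chain_within[OF \<gamma>'[of t "{r..\<rho>}"] has_field_derivative_at_within[OF F[OF \<gamma>[OF that]]]]
        by (simp add: o_def)
    qed (use \<rho> in simp)
    note I = this
    have cont: "continuous_on {r..\<rho>} (\<lambda>t. deriv g (\<gamma> t))"
    proof (rule continuous_on_compose2[of unit_disk "deriv g" _ \<gamma>])
      show "continuous_on unit_disk (deriv g)"
        using g by (intro holomorphic_on_imp_continuous_on holomorphic_deriv) auto
      show "continuous_on {r..\<rho>} \<gamma>" unfolding \<gamma>_def by (intro continuous_intros)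
    qed (use \<gamma> in auto)
    define J where "J = integral {r..\<rho>} (\<lambda>t. cmod (deriv g (\<gamma> t)))"
    have J: "((\<lambda>t. cmod (deriv g (\<gamma> t))) has_integral J) {r..\<rho>}"
      unfolding J_def by (intro integrable_integral integrable_continuous_interval continuous_intros cont)
    have "ennreal J = (\<integral>\<^sup>+ t \<in> {r..\<rho>}. ennreal (cmod (deriv g (\<gamma> t))) \<partial>lborel)"
      by (rule nn_integral_has_integral_lebesgue'[OF _ J, symmetric]) simp
    also have "\<dots> \<le> (\<integral>\<^sup>+ t \<in> {r..<1}. ennreal (cmod (deriv g (\<gamma> t))) \<partial>lborel)"
      using \<rho> by (intro nn_integral_mono) (auto simp: indicator_def)
    also have "\<dots> \<le> ennreal \<epsilon>" using \<epsilon>[OF \<theta>] by (simp add: \<gamma>_def)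
    finally have "J \<le> \<epsilon>" using \<open>0 \<le> \<epsilon>\<close> by (simp add: ennreal_le_iff)
    have "cmod (F (\<gamma> \<rho>) - F (\<gamma> r)) \<le> M * J"
      unfolding integral_unique[OF I, symmetric] integral_unique[OF has_integral_mult_right[OF J], symmetric]
    proof (rule integral_norm_bound_integral)
      show "norm (cis \<theta> * (f (\<gamma> t) * deriv g (\<gamma> t))) \<le> M * cmod (deriv g (\<gamma> t))" if "t \<in> {r..\<rho>}" for t
        using M[OF \<gamma>[OF that]] by (simp add: norm_mult mult_right_mono)
    qed (use I has_integral_mult_right[OF J] in \<open>auto simp: integrable_on_def\<close>)
    also have "\<dots> \<le> M * \<epsilon>" using \<open>J \<le> \<epsilon>\<close> \<open>0 \<le> M\<close> by (rule mult_left_mono)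
    finally have "cmod (F z - F (\<gamma> r)) \<le> M * \<epsilon>" by (simp add: z_polar \<gamma>_def)
    moreover have "cmod (F (\<gamma> r) - F 0) \<le> \<delta> * B" using r by (intro inner) (simp add: \<gamma>_def norm_mult)
    moreover have "volterra g f z = (F (\<gamma> r) - F 0) + (F z - F (\<gamma> r))" using VF[OF z] by simp
    ultimately show ?thesis by (metis norm_triangle_mono)
  qed
qed

text \<open>
  The data that \<open>volterra_bound\<close> needs: the tail of the radial integrals determines \<open>r\<close>, and compactness
  of the disc of radius \<open>r\<close> gives \<open>B\<close>.
\<close>

lemma unif_integrable_radii_split:
  assumes "g \<in> unif_integrable_radii" "0 < \<epsilon>"
  shows "\<exists>r B. 0 \<le> r \<and> r < 1 \<and> 0 \<le> B \<and> (\<forall>w\<in>cball 0 r. cmod (deriv g w) \<le> B) \<and>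
    (\<forall>\<theta>\<in>{0..<2*pi}.
      (\<integral>\<^sup>+ t \<in> {r..<1}. ennreal (cmod (deriv g (of_real t * cis \<theta>))) \<partial>lborel) \<le> ennreal \<epsilon>)"
proof -
  from assms obtain r where r: "0 \<le> r" "r < 1" and tail: "\<forall>\<theta>\<in>{0..<2*pi}.
      (\<integral>\<^sup>+ t \<in> {r..<1}. ennreal (cmod (deriv g (of_real t * cis \<theta>))) \<partial>lborel) \<le> ennreal \<epsilon>"
    and g: "g holomorphic_on unit_disk"
    unfolding unif_integrable_radii_def by blast
  have "continuous_on (cball 0 r) (deriv g)"
    using holomorphic_on_imp_continuous_on[OF holomorphic_deriv[OF g open_ball]] r
    by (elim continuous_on_subset) auto
  hence "bounded (deriv g ` cball 0 r)" by (intro compact_imp_bounded compact_continuous_image) auto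
  then obtain B where "0 < B" "\<forall>w\<in>cball 0 r. cmod (deriv g w) \<le> B"
    unfolding bounded_pos by auto
  with r tail show ?thesis by (intro exI[of _ r] exI[of _ B]) auto
qed

lemma hinf_restrict:
  assumes "h holomorphic_on unit_disk" and "\<And>z. z \<in> unit_disk \<Longrightarrow> cmod (h z) \<le> M"
  obtains \<phi> where "\<And>z. z \<in> unit_disk \<Longrightarrow> hinf_apply \<phi> z = h z" "norm \<phi> \<le> M"
proof -
  have "(\<lambda>z. if z \<in> unit_disk then h z else 0) holomorphic_on unit_disk"
    using assms(1) by (rule holomorphic_transform) simp
  moreover have "bounded ((\<lambda>z. if z \<in> unit_disk then h z else 0) ` unit_disk)"
    unfolding bounded_iff using assms(2) by (intro exI[of _ M]) auto
  ultimately have "hinf_apply (Abs_hinf (\<lambda>z. if z \<in> unit_disk then h z else 0)) z = h z" if "z \<in> unit_disk" for z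
    using that by (subst Abs_hinf_inverse) auto
  with assms(2) show thesis by (intro that hinf_norm_leI) auto
qed

text \<open>
  That the operator preserves boundedness is the case \<open>\<epsilon> = 1\<close> of \<open>volterra_bound\<close>, with the norm of \<open>f\<close> for
  both \<open>\<delta>\<close> and \<open>M\<close>.
\<close>

lemma volterra_hinf_operator:
  assumes "g \<in> unif_integrable_radii"
  obtains T :: "hinf \<Rightarrow> hinf" where "linear T"
    "\<And>f z. z \<in> unit_disk \<Longrightarrow> hinf_apply (T f) z = volterra g (hinf_apply f) z"
proof -
  have g: "g holomorphic_on unit_disk" using assms by (simp add: unif_integrable_radii_def)
  obtain r B where rB: "0 \<le> r" "r < 1" "0 \<le> B" "\<forall>w\<in>cball 0 r. cmod (deriv g w) \<le> B"
    "\<forall>\<theta>\<in>{0..<2*pi}.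
      (\<integral>\<^sup>+ t \<in> {r..<1}. ennreal (cmod (deriv g (of_real t * cis \<theta>))) \<partial>lborel) \<le> ennreal 1"
    using unif_integrable_radii_split[OF assms zero_less_one] by blast
  have "\<exists>\<phi>. \<forall>z\<in>unit_disk. hinf_apply \<phi> z = volterra g (hinf_apply f) z" for f
  proof -
    obtain F where F: "\<And>z. z \<in> unit_disk \<Longrightarrow> (F has_field_derivative hinf_apply f z * deriv g z) (at z)"
      and VF: "\<And>z. z \<in> unit_disk \<Longrightarrow> volterra g (hinf_apply f) z = F z - F 0"
      using volterra_primitive[OF g hinf_holomorphic] by metis
    have "F holomorphic_on unit_disk" unfolding holomorphic_on_open[OF open_ball] using F by blast
    hence "(\<lambda>z. F z - F 0) holomorphic_on unit_disk" by (intro holomorphic_intros)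
    hence hol: "volterra g (hinf_apply f) holomorphic_on unit_disk"
      by (rule holomorphic_transform) (simp add: VF)
    have "cmod (volterra g (hinf_apply f) z) \<le> norm f * B + norm f * 1" if "z \<in> unit_disk" for z
      using rB that by (intro volterra_bound[OF g hinf_holomorphic, where r = r]) (auto intro!: hinf_apply_le_norm)
    from hinf_restrict[OF hol this] show ?thesis by metis
  qed
  then obtain T where T: "\<And>f z. z \<in> unit_disk \<Longrightarrow> hinf_apply (T f) z = volterra g (hinf_apply f) z"
    by metis
  have ci: "(\<lambda>t. hinf_apply f t * deriv g t) contour_integrable_on linepath 0 z" if "z \<in> unit_disk" for f z
  proof (rule contour_integrable_continuous_linepath)
    have "closed_segment 0 z \<subseteq> unit_disk" using that by (intro closed_segment_subset) auto
    moreover have "(\<lambda>t. hinf_apply f t * deriv g t) holomorphic_on unit_disk"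
      using g by (intro holomorphic_intros hinf_holomorphic) auto
    ultimately show "continuous_on (closed_segment 0 z) (\<lambda>t. hinf_apply f t * deriv g t)"
      using holomorphic_on_imp_continuous_on continuous_on_subset by blast
  qed
  have "linear T"
  proof (rule linearI)
    show "T (f + h) = T f + T h" for f h
      by (rule hinf_eqI)
         (simp add: T plus_hinf.rep_eq volterra_def distrib_right contour_integral_add ci)
    show "T (c *\<^sub>R f) = c *\<^sub>R T f" for c f
      by (rule hinf_eqI)
         (simp add: T scaleR_hinf.rep_eq volterra_def scaleR_conv_of_real mult.assoc contour_integral_lmul ci)
  qed
  from this T show thesis by (rule that)
qed

text \<open>
  By Montel's theorem a bounded sequence has a locally uniformly convergent subsequence, whose limit
  lies in the same closed ball, and \<open>volterra_bound\<close> turns this convergence into convergence in norm of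
  the images.
\<close>

lemma volterra_image_of_ball_compact:
  assumes gU: "g \<in> unif_integrable_radii" and lin: "linear T"
    and T: "\<And>f z. z \<in> unit_disk \<Longrightarrow> hinf_apply (T f) z = volterra g (hinf_apply f) z"
    and "0 \<le> M"
  shows "compact (T ` cball (0::hinf) M :: hinf set)"
  unfolding compact_eq_seq_compact_metric seq_compact_def
proof (intro allI impI)
  have g: "g holomorphic_on unit_disk" using gU by (simp add: unif_integrable_radii_def)
  fix x :: "nat \<Rightarrow> hinf" assume "\<forall>n. x n \<in> T ` cball 0 M"
  hence "\<forall>n. \<exists>y. norm y \<le> M \<and> x n = T y" by (metis imageE mem_cball_0)
  then obtain f where f: "\<And>n. norm (f n) \<le> M" and x: "\<And>n. x n = T (f n)" by metis
  define H where "H = {h. h holomorphic_on unit_disk \<and> (\<forall>z\<in>unit_disk. cmod (h z) \<le> M)}"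
  have fM: "cmod (hinf_apply (f n) z) \<le> M" if "z \<in> unit_disk" for n z
    using hinf_apply_le_norm[OF that, of "f n"] f[of n] by simp
  obtain h s where h: "h holomorphic_on unit_disk" and s: "strict_mono (s :: nat \<Rightarrow> nat)"
    and pw: "\<And>z. z \<in> unit_disk \<Longrightarrow> (\<lambda>n. hinf_apply (f (s n)) z) \<longlonglongrightarrow> h z"
    and unif: "\<And>K. compact K \<Longrightarrow> K \<subseteq> unit_disk \<Longrightarrow> uniform_limit K ((\<lambda>n. hinf_apply (f n)) \<circ> s) h sequentially"
  proof (rule Montel[of unit_disk H "\<lambda>n. hinf_apply (f n)"])
    show "\<exists>B. \<forall>h\<in>H. \<forall>z\<in>K. norm (h z) \<le> B" if "K \<subseteq> unit_disk" for K
      using that by (intro exI[of _ M]) (auto simp: H_def)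
    show "range (\<lambda>n. hinf_apply (f n)) \<subseteq> H" by (auto simp: H_def hinf_holomorphic fM)
  qed (auto simp: H_def)
  have "cmod (h z) \<le> M" if "z \<in> unit_disk" for z
    by (rule Lim_bounded[OF tendsto_norm[OF pw[OF that]], of 0]) (simp add: fM[OF that])
  then obtain \<phi> where \<phi>: "\<And>z. z \<in> unit_disk \<Longrightarrow> hinf_apply \<phi> z = h z" and "norm \<phi> \<le> M"
    using hinf_restrict[OF h, of M] by metis
  have "(x \<circ> s) \<longlonglongrightarrow> T \<phi>"
  proof (rule metric_LIMSEQ_I)
    fix e :: real assume "0 < e"
    define \<epsilon> where "\<epsilon> = e / (4 * (M + 1))"
    have "0 < \<epsilon>" using \<open>0 < e\<close> \<open>0 \<le> M\<close> by (simp add: \<epsilon>_def)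
    obtain r B where rB: "0 \<le> r" "r < 1" "0 \<le> B" "\<forall>w\<in>cball 0 r. cmod (deriv g w) \<le> B"
      "\<forall>\<theta>\<in>{0..<2*pi}.
        (\<integral>\<^sup>+ t \<in> {r..<1}. ennreal (cmod (deriv g (of_real t * cis \<theta>))) \<partial>lborel) \<le> ennreal \<epsilon>"
      using unif_integrable_radii_split[OF gU \<open>0 < \<epsilon>\<close>] by blast
    define \<delta> where "\<delta> = e / (2 * (B + 1))"
    have "0 < \<delta>" using \<open>0 < e\<close> \<open>0 \<le> B\<close> by (simp add: \<delta>_def)
    have "\<forall>\<^sub>F n in sequentially. \<forall>w\<in>cball 0 r. dist (((\<lambda>n. hinf_apply (f n)) \<circ> s) n w) (h w) < \<delta>"
      using rB(2) by (intro uniform_limitD[OF unif] \<open>0 < \<delta>\<close>) auto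
    then obtain N where N: "\<And>n w. n \<ge> N \<Longrightarrow> w \<in> cball 0 r \<Longrightarrow> cmod (hinf_apply (f (s n)) w - h w) < \<delta>"
      unfolding eventually_sequentially dist_norm o_def by blast
    have "dist ((x \<circ> s) n) (T \<phi>) < e" if "n \<ge> N" for n
    proof -
      define d where "d = f (s n) - \<phi>"
      have d_le: "norm d \<le> 2 * M"
        using norm_triangle_ineq4[of "f (s n)" \<phi>] f[of "s n"] \<open>norm \<phi> \<le> M\<close> by (simp add: d_def)
      have "norm (T d) \<le> \<delta> * B + 2 * M * \<epsilon>"
      proof (rule hinf_norm_leI)
        fix z :: complex assume z: "z \<in> unit_disk"
        show "cmod (hinf_apply (T d) z) \<le> \<delta> * B + 2 * M * \<epsilon>"
          unfolding T[OF z]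
        proof (rule volterra_bound[OF g hinf_holomorphic])
          show "cmod (hinf_apply d w) \<le> 2 * M" if "w \<in> unit_disk" for w
            using hinf_apply_le_norm[OF that, of d] d_le by simp
          show "cmod (hinf_apply d w) \<le> \<delta>" if "w \<in> cball 0 r" for w
            using N[OF \<open>n \<ge> N\<close> that] \<phi>[of w] that rB(2) by (simp add: d_def minus_hinf.rep_eq)
        qed (use rB z \<open>0 < \<delta>\<close> \<open>0 < \<epsilon>\<close> in auto)
      qed
      moreover have "\<delta> * B < e / 2" using \<open>0 < e\<close> \<open>0 \<le> B\<close> by (simp add: \<delta>_def field_simps)
      moreover have "2 * M * \<epsilon> < e / 2" using \<open>0 < e\<close> \<open>0 \<le> M\<close> by (simp add: \<epsilon>_def field_simps)
      moreover have "dist ((x \<circ> s) n) (T \<phi>) = norm (T d)"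
        by (simp add: dist_norm x d_def linear_diff[OF lin])
      ultimately show ?thesis by linarith
    qed
    thus "\<exists>N. \<forall>n\<ge>N. dist ((x \<circ> s) n) (T \<phi>) < e" by blast
  qed
  moreover have "T \<phi> \<in> T ` cball 0 M" using \<open>norm \<phi> \<le> M\<close> by simp
  ultimately show "\<exists>l\<in>T ` cball 0 M. \<exists>r. strict_mono r \<and> (x \<circ> r) \<longlonglongrightarrow> l" using s by blast
qed

lemma unif_integrable_radii_subset_compact: "unif_integrable_radii \<subseteq> compact_volterra_hinf"
proof
  fix g assume gU: "g \<in> unif_integrable_radii"
  obtain T :: "hinf \<Rightarrow> hinf" where lin: "linear T"
    and T: "\<And>f z. z \<in> unit_disk \<Longrightarrow> hinf_apply (T f) z = volterra g (hinf_apply f) z"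
    using volterra_hinf_operator[OF gU] by metis
  have "compact (closure (T ` S))" if S: "bounded S" for S
  proof -
    obtain M where M: "0 < M" "\<And>f. f \<in> S \<Longrightarrow> norm f \<le> M" using S unfolding bounded_pos by blast
    have K: "compact (T ` cball 0 M)"
      using M by (intro volterra_image_of_ball_compact[OF gU lin T]) auto
    have "closure (T ` S) \<subseteq> T ` cball 0 M"
      using M by (intro closure_minimal compact_imp_closed[OF K] image_mono) auto
    thus ?thesis using closed_Int_compact[OF closed_closure K, of "T ` S"] by (simp add: Int_absorb2)
  qed
  with lin have "compact_operator T" by (simp add: compact_operator_def)
  with T gU show "g \<in> compact_volterra_hinf"
    unfolding compact_volterra_hinf_def unif_integrable_radii_def by blast
qed

section \<open>The chain of inclusions\<close>

theorem proposition3p4: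
  shows "hardy_1_1 \<subset> ell_1_disk \<and> ell_1_disk \<subset> unif_integrable_radii \<and>
         unif_integrable_radii \<subseteq> compact_volterra_hinf"
  using hardy_1_1_subset_ell_1 lacunary_ell_1_not_hardy_1_1
    ell_1_subset_unif_integrable_radii rudin_shapiro_unif_integrable_not_ell_1
    unif_integrable_radii_subset_compact
  by blast

end
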